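(* Let $m/n\in(0,1/2)$. There is a bijection $\phi\colon\mathcal P(1/2,0,B)\to\mathcal P(m/n,m-1,B)$ defined on data as follows: in the cycle representation of $\pi$, replace each occurrence of $(0,s)$ (keeping its label $A$, $B$ or $C$) by the string $(m-1,s)\to(2m-1,s)\to\cdots\to(n-m,s)\to(0,s)$, i.e. the points $(r,s)$ for $r$ running through $\mathcal O_{m/n}[m-1,0]$ in order, and each occurrence of $(1,s)$ by the string $(m,s)\to(2m,s)\to\cdots\to(n-1,s)$, i.e. the points $(r,s)$ for $r$ running through $\mathcal O_{m/n}[m,n-1]$ in order; the partition $(A,B,C)$ is unchanged. Moreover $\phi$ restricts to a bijection $TT(1/2,0,B)\to TT(m/n,m-1,B)$.
   Context: $\Gamma_n$ is an $n$-star (edges $e_0,\dots,e_{n-1}$, central vertex $v$); $f_{m/n}(e_0)=e_0\bar e_1e_1\cdots\bar e_me_m$, $f_{m/n}(e_r)=e_{r+_nm}$ ($r\ne0$), with $+_n$ addition mod $n$. $\mathcal O_{m/n}[r,s]=\{r+_njm\colon0\le j\le k\}$ with $k\ge0$ least such that $r+_nkm=s$. A $\ast$-orbit is a periodic orbit $P\ne\{v\}$ of $f_{m/n}$ meeting every edge, with $f_{m/n}(P\cap e_0)\not\subseteq e_m$ and $f(p_r)=p_{r+_nm}$ for $r\neq 0$ ($p_r$ the point of $P\cap e_r$ nearest the initial point of $e_r$). Its data $((N_r),\pi,(A,B,C))$: $N_r=\#(P\cap e_r)$, points labelled $(r,0),\dots,(r,N_r-1)$ from initial to final point, $\pi=f|_P$,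 and $s\in A,B,C$ according as the truncated map ($f$ followed by retraction onto the span of $P$) is locally orientation-reversing, orientation-preserving, or not injective at $(0,s)$. $\mathcal P(m/n,k,\gamma)$ is the set of $\ast$-orbits with $\pi(0,0)\in e_k$ and $0\in\gamma$; $\ast$-orbits with equal data are identified. $TT(m/n,k,\gamma)\subseteq\mathcal P(m/n,k,\gamma)$ consists of those satisfying: with $\alpha\cup\beta$ the partition of $\mathcal L\setminus\{(r,0)\}$ given by $\pi^{-1}(m,0)\in\beta$ and, for $2\le i\le\#P-n$, $\pi^{-i}(m,0)$, $\pi^{-i+1}(m,0)$ in different sets iff $\tau_1(\pi^{-i}(m,0))=0$ and $\tau_2(\pi^{-i}(m,0))\in A$ ($\tau_1,\tau_2$ coordinate projections, $\pi_i=\tau_i\circ\pi$): (a) for $0\le s<N_0-1$, $\pi(0,s)\in\alpha$ if $s\in B$, $\in\beta$ if $s\in A$; (b) $N_{r+n-m}=1$ for $k<r<m$; (c) if $s>0$ and $\pi_2(k+n-m,s)>\pi_2(0,0)$ then $\pi(k+n-m,s)\in\beta$; (d) if $\gamma=A$ then $\pi_2(k+n-m,s)>\pi_2(0,0)$ for all $s>0$. *)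

theory Defs
  imports Complex_Main
begin

text \<open>Points of the n-star Gamma_n are pairs (r,t) with r < n, 0 <= t < 1 (a point in the
interior or at the initial point of edge e_r; t = 0 is the initial (outer) point of e_r and the
edge is oriented towards the centre), together with the central vertex v, represented by (0,1).\<close>

definition vtx :: "nat \<times> real" where "vtx = (0, 1)"

definition star :: "nat \<Rightarrow> (nat \<times> real) set" where
  "star n = {(r, t). r < n \<and> 0 \<le> t \<and> t < 1} \<union> {vtx}"

definition mkpt :: "nat \<Rightarrow> real \<Rightarrow> nat \<times> real" where
  "mkpt r t = (if t = 1 then vtx else (r, t))"

text \<open>The piecewise-linear representative of f_{m/n}: e_0 is cut into 2m+1 equal pieces, mapped
linearly onto e_0, \bar e_1, e_1, ..., \bar e_m, e_m in turn; e_r (r \<noteq> 0) is mapped isometrically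
onto e_{r +_n m}; v is fixed.\<close>

definition fmap :: "nat \<Rightarrow> nat \<Rightarrow> nat \<times> real \<Rightarrow> nat \<times> real" where
  "fmap m n p = (let r = fst p; t = snd p in
     if 1 \<le> t then vtx
     else if r \<noteq> 0 then ((r + m) mod n, t)
     else (let u = real (2 * m + 1) * t; j = nat \<lfloor>u\<rfloor>; \<theta> = u - of_int \<lfloor>u\<rfloor> in
           if j = 0 then (0, \<theta>)
           else if odd j then mkpt ((j + 1) div 2) (1 - \<theta>)
           else (j div 2, \<theta>)))"

definition periodic_orbit :: "nat \<Rightarrow> nat \<Rightarrow> (nat \<times> real) set \<Rightarrow> bool" where
  "periodic_orbit m n P \<longleftrightarrow> (\<exists>x p. x \<in> star n \<and> 0 < p \<and> (fmap m n ^^ p) x = x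
      \<and> P = range (\<lambda>i. (fmap m n ^^ i) x))"

definition edgepts :: "(nat \<times> real) set \<Rightarrow> nat \<Rightarrow> real set" where
  "edgepts P r = {t. (r, t) \<in> P \<and> t < 1}"

definition tmin :: "(nat \<times> real) set \<Rightarrow> nat \<Rightarrow> real" where
  "tmin P r = Min (edgepts P r)"

definition star_orbit :: "nat \<Rightarrow> nat \<Rightarrow> (nat \<times> real) set \<Rightarrow> bool" where
  "star_orbit m n P \<longleftrightarrow> periodic_orbit m n P \<and> P \<noteq> {vtx}
     \<and> (\<forall>r<n. edgepts P r \<noteq> {})
     \<and> \<not> (fmap m n ` {(0, t) | t. t \<in> edgepts P 0} \<subseteq> {(m, t) | t. t < 1} \<union> {vtx})
     \<and> (\<forall>r. 0 < r \<and> r < n \<longrightarrow>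
           fmap m n (r, tmin P r) = ((r + m) mod n, tmin P ((r + m) mod n)))"

record sdata =
  Nc :: "nat \<Rightarrow> nat"
  perm :: "nat \<times> nat \<Rightarrow> nat \<times> nat"
  Aset :: "nat set"
  Bset :: "nat set"
  Cset :: "nat set"

definition Lab :: "nat \<Rightarrow> (nat \<Rightarrow> nat) \<Rightarrow> (nat \<times> nat) set" where
  "Lab n N = {(r, s). r < n \<and> s < N r}"

definition lab :: "(nat \<times> real) set \<Rightarrow> nat \<times> real \<Rightarrow> nat \<times> nat" where
  "lab P q = (fst q, card {t' \<in> edgepts P (fst q). t' < snd q})"

definition ptof :: "(nat \<times> real) set \<Rightarrow> nat \<times> nat \<Rightarrow> nat \<times> real" where
  "ptof P x = (THE q. q \<in> P \<and> lab P q = x)"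

definition retr :: "(nat \<times> real) set \<Rightarrow> nat \<times> real \<Rightarrow> nat \<times> real" where
  "retr P q = (if q = vtx then vtx else (fst q, max (snd q) (tmin P (fst q))))"

definition trunc :: "nat \<Rightarrow> nat \<Rightarrow> (nat \<times> real) set \<Rightarrow> nat \<times> real \<Rightarrow> nat \<times> real" where
  "trunc m n P = retr P \<circ> fmap m n"

definition loc_rev :: "(nat \<times> real \<Rightarrow> nat \<times> real) \<Rightarrow> real \<Rightarrow> bool" where
  "loc_rev g t0 \<longleftrightarrow> (\<exists>\<epsilon>>0. 0 < t0 - \<epsilon> \<and> t0 + \<epsilon> < 1 \<and> (\<exists>j. \<forall>t1 t2.
      t0 - \<epsilon> < t1 \<longrightarrow> t1 < t2 \<longrightarrow> t2 < t0 + \<epsilon> \<longrightarrow>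
      fst (g (0, t1)) = j \<and> fst (g (0, t2)) = j \<and> snd (g (0, t2)) < snd (g (0, t1))
      \<and> snd (g (0, t1)) < 1))"

definition loc_pres :: "(nat \<times> real \<Rightarrow> nat \<times> real) \<Rightarrow> real \<Rightarrow> bool" where
  "loc_pres g t0 \<longleftrightarrow> (\<exists>\<epsilon>>0. 0 < t0 - \<epsilon> \<and> t0 + \<epsilon> < 1 \<and> (\<exists>j. \<forall>t1 t2.
      t0 - \<epsilon> < t1 \<longrightarrow> t1 < t2 \<longrightarrow> t2 < t0 + \<epsilon> \<longrightarrow>
      fst (g (0, t1)) = j \<and> fst (g (0, t2)) = j \<and> snd (g (0, t1)) < snd (g (0, t2))
      \<and> snd (g (0, t2)) < 1))"

definition loc_noninj :: "(nat \<times> real \<Rightarrow> nat \<times> real) \<Rightarrow> real \<Rightarrow> bool" where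
  "loc_noninj g t0 \<longleftrightarrow> (\<forall>\<epsilon>>0. \<exists>t1 t2. t1 \<noteq> t2 \<and> \<bar>t1 - t0\<bar> < \<epsilon> \<and> \<bar>t2 - t0\<bar> < \<epsilon>
      \<and> 0 \<le> t1 \<and> t1 < 1 \<and> 0 \<le> t2 \<and> t2 < 1 \<and> g (0, t1) = g (0, t2))"

definition dataof :: "nat \<Rightarrow> nat \<Rightarrow> (nat \<times> real) set \<Rightarrow> sdata" where
  "dataof m n P = (let N = (\<lambda>r. if r < n then card (edgepts P r) else 0);
                       g = trunc m n P;
                       tp = (\<lambda>s. snd (ptof P (0, s))) in
     \<lparr> Nc = N,
       perm = (\<lambda>x. if x \<in> Lab n N then lab P (fmap m n (ptof P x)) else x),
       Aset = {s. s < N 0 \<and> loc_rev g (tp s)},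
       Bset = {s. s < N 0 \<and> loc_pres g (tp s)},
       Cset = {s. s < N 0 \<and> loc_noninj g (tp s)} \<rparr>)"

datatype lbl = LA | LB | LC

fun sel :: "lbl \<Rightarrow> sdata \<Rightarrow> nat set" where
  "sel LA D = Aset D" | "sel LB D = Bset D" | "sel LC D = Cset D"

definition Pset :: "nat \<Rightarrow> nat \<Rightarrow> nat \<Rightarrow> lbl \<Rightarrow> sdata set" where
  "Pset m n k \<gamma> = {dataof m n P | P. star_orbit m n P
       \<and> fst (perm (dataof m n P) (0, 0)) = k \<and> 0 \<in> sel \<gamma> (dataof m n P)}"

fun cflag :: "(nat \<times> nat \<Rightarrow> nat \<times> nat) \<Rightarrow> nat set \<Rightarrow> nat \<Rightarrow> nat \<Rightarrow> bool" where
  "cflag pinv A m 0 = True"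
| "cflag pinv A m (Suc j) = (let x = (pinv ^^ (j + 2)) (m, 0) in
     if fst x = 0 \<and> snd x \<in> A then \<not> cflag pinv A m j else cflag pinv A m j)"

text \<open>cflag j = True means \<pi>^{-(j+1)}(m,0) \<in> \<beta>.\<close>
definition pinv :: "nat \<Rightarrow> sdata \<Rightarrow> nat \<times> nat \<Rightarrow> nat \<times> nat" where
  "pinv n D = the_inv_into (Lab n (Nc D)) (perm D)"

definition npts :: "nat \<Rightarrow> sdata \<Rightarrow> nat" where
  "npts n D = (\<Sum>r<n. Nc D r)"

definition betaset :: "nat \<Rightarrow> nat \<Rightarrow> sdata \<Rightarrow> (nat \<times> nat) set" where
  "betaset m n D = {(pinv n D ^^ (j + 1)) (m, 0) | j. j + 1 \<le> npts n D - n
       \<and> cflag (pinv n D) (Aset D) m j}"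

definition alphaset :: "nat \<Rightarrow> nat \<Rightarrow> sdata \<Rightarrow> (nat \<times> nat) set" where
  "alphaset m n D = {(pinv n D ^^ (j + 1)) (m, 0) | j. j + 1 \<le> npts n D - n
       \<and> \<not> cflag (pinv n D) (Aset D) m j}"

definition TTcond :: "nat \<Rightarrow> nat \<Rightarrow> nat \<Rightarrow> lbl \<Rightarrow> sdata \<Rightarrow> bool" where
  "TTcond m n k \<gamma> D \<longleftrightarrow> (let N = Nc D; \<pi> = perm D; q = (k + n - m) mod n in
     (\<forall>s. s + 1 < N 0 \<longrightarrow>
         (s \<in> Bset D \<longrightarrow> \<pi> (0, s) \<in> alphaset m n D) \<and>
         (s \<in> Aset D \<longrightarrow> \<pi> (0, s) \<in> betaset m n D))
   \<and> (\<forall>r. k < r \<and> r < m \<longrightarrow> N (r + n - m) = 1)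
   \<and> (\<forall>s. 0 < s \<and> s < N q \<longrightarrow> snd (\<pi> (q, s)) > snd (\<pi> (0, 0)) \<longrightarrow> \<pi> (q, s) \<in> betaset m n D)
   \<and> (\<gamma> = LA \<longrightarrow> (\<forall>s. 0 < s \<and> s < N q \<longrightarrow> snd (\<pi> (q, s)) > snd (\<pi> (0, 0)))))"

definition TT :: "nat \<Rightarrow> nat \<Rightarrow> nat \<Rightarrow> lbl \<Rightarrow> sdata set" where
  "TT m n k \<gamma> = {D \<in> Pset m n k \<gamma>. TTcond m n k \<gamma> D}"

definition Orb :: "nat \<Rightarrow> nat \<Rightarrow> nat \<Rightarrow> nat \<Rightarrow> nat set" where
  "Orb m n r s = (let k = (LEAST k. (r + k * m) mod n = s) in {(r + j * m) mod n | j. j \<le> k})"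

text \<open>Head of the string replacing a label of the 1/2-data: (0,s) \<mapsto> (m-1,s), (1,s) \<mapsto> (m,s).\<close>
definition hd_str :: "nat \<Rightarrow> nat \<times> nat \<Rightarrow> nat \<times> nat" where
  "hd_str m x = (if fst x = 0 then m - 1 else m, snd x)"

text \<open>In the new cycle, (r,s) \<mapsto> (r +_n m, s) inside a string; the last element (0,s) of the
string for (0,s) goes to the head of the string of \<pi>(0,s); the last element (n-1,s) of the
string for (1,s) goes to the head of the string of \<pi>(1,s).\<close>
definition phi :: "nat \<Rightarrow> nat \<Rightarrow> sdata \<Rightarrow> sdata" where
  "phi m n D = (let N' = (\<lambda>r. if r < n then (if r \<in> Orb m n (m - 1) 0 then Nc D 0 else Nc D 1) else 0) in
     \<lparr> Nc = N',
       perm = (\<lambda>x. if x \<in> Lab n N' then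
                     (if fst x = 0 then hd_str m (perm D (0, snd x))
                      else if fst x = n - 1 then hd_str m (perm D (1, snd x))
                      else ((fst x + m) mod n, snd x))
                   else x),
       Aset = Aset D, Bset = Bset D, Cset = Cset D \<rparr>)"

end

theory Submission
  imports Defs "HOL-Number_Theory.Cong"
begin

text \<open>
  A point that leaves \<open>e\<^sub>0\<close> is carried isometrically around the star until it returns, so the first
  return map to \<open>e\<^sub>0\<close> is the zigzag map with \<open>2m + 1\<close> pieces. An orbit in \<open>P(m/n, m - 1, B)\<close> meets
  \<open>e\<^sub>0\<close> in a periodic orbit \<open>X\<close> of the zigzag map that lies in the last three pieces. The first of
  them enters at \<open>e\<^bsub>m-1\<^esub>\<close> and visits the edges of \<open>O[m - 1, 0]\<close>; the other two enter at \<open>e\<^sub>m\<close> and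
  visit all edges. Hence the edges of \<open>O[m - 1, 0]\<close> carry \<open>X\<close>, the others carry the image of the
  points in the last two pieces, and the whole orbit is recovered from \<open>X\<close>. The last three pieces of
  the zigzag maps for \<open>m\<close> and \<open>1\<close> have the same orientations, so a periodic orbit in them can be
  exchanged for the one with the same itinerary, in the same order on the line; on data this is \<open>\<phi>\<close>.
  The set \<open>\<beta>\<close> is determined by a recursion along the cycle that changes side only at points of
  \<open>e\<^sub>0\<close> labelled \<open>A\<close>, hence is constant along the strings that \<open>\<phi>\<close> inserts.
\<close>

section \<open>The rotation on the edges\<close>

text \<open>Two pieces of e_0 can land on e_{m-1}: 2m - 2 and, for m > 1, also 2m - 3. Label B on
  the first point selects the even one, and pieces increase along the edge, so just three pieces
  remain whatever m is. This is what makes different m comparable. The exchange of orbits asks for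
  reals that satisfy a prescribed affine recursion along a cycle. A series provides them, but only
  as real numbers; the main work is to confine them strictly between 0 and 1, as a value 0 or 1
  would put a point on an outer end or on the vertex. This is where it matters that the orbit visits
  both the lowest of the three pieces and one of the other two. Since orbits enter the theorem only
  through their data, the exchange alone shows that \<open>phi\<close> is well placed and onto;
  injectivity is read off the data themselves.\<close>

locale star_map =
  fixes m n :: nat
  assumes m_pos: "0 < m" and m_less: "m < n" and cop: "coprime m n"
begin

lemma n_ge_2: "2 \<le> n"
  using m_pos m_less by linarith

text \<open>Coprimality makes m invertible modulo n: if m * x is congruent to 1, then k = (q - r) *
  x works. Adding n keeps the subtraction within the naturals.\<close>

lemma edge_reach:
  assumes "r < n" "q < n"
  shows "\<exists>k. (r + k * m) mod n = q"
proof -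
  obtain x where x: "[m * x = Suc 0] (mod n)"
    using cong_solve_coprime_nat[OF cop] by auto
  have "[(q + n - r) * (m * x) = (q + n - r) * Suc 0] (mod n)"
    by (rule cong_scalar_left[OF x])
  then have "[r + (q + n - r) * (m * x) = r + (q + n - r) * Suc 0] (mod n)"
    by (rule cong_add[OF cong_refl])
  moreover have "r + (q + n - r) * Suc 0 = q + n" using assms by simp
  moreover have "r + (q + n - r) * (m * x) = r + ((q + n - r) * x) * m" by simp
  ultimately have "(r + ((q + n - r) * x) * m) mod n = q"
    using assms(2) unfolding cong_def by simp
  then show ?thesis by (rule exI)
qed

lemma forward_induct:
  assumes "r\<^sub>0 < n" "r < n" "Q r\<^sub>0" and step: "\<And>r. r < n \<Longrightarrow> Q r \<Longrightarrow> Q ((r + m) mod n)"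
  shows "Q r"
proof -
  obtain k where k: "(r\<^sub>0 + k * m) mod n = r"
    using edge_reach[OF assms(1,2)] by (elim exE)
  have "Q ((r\<^sub>0 + j * m) mod n)" for j
  proof (induction j)
    case 0
    then show ?case using assms(1,3) by simp
  next
    case (Suc j)
    have "((r\<^sub>0 + j * m) mod n + m) mod n = (r\<^sub>0 + j * m + m) mod n"
      by (rule mod_add_left_eq)
    then show ?case using step[OF _ Suc] assms(1) by (simp add: algebra_simps)
  qed
  from this[of k] show ?thesis unfolding k .
qed

lemma edge_induct [consumes 1, case_names zero step]:
  assumes "r < n" and zero: "Q 0"
    and step: "\<And>r. 0 < r \<Longrightarrow> r < n \<Longrightarrow> Q ((r + m) mod n) \<Longrightarrow> Q r"
  shows "Q r"
proof -
  have "0 < n" using assms(1) by simp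
  from edge_reach[OF assms(1) this] obtain k where "(r + k * m) mod n = 0"
    by (elim exE)
  then show ?thesis
    using \<open>r < n\<close>
  proof (induction k arbitrary: r)
    case 0
    then show ?case using zero by simp
  next
    case (Suc k)
    have "((r + m) mod n + k * m) mod n = (r + m + k * m) mod n"
      by (rule mod_add_left_eq)
    also have "\<dots> = 0" using Suc.prems(1) by (simp add: algebra_simps)
    finally have "Q ((r + m) mod n)"
      using Suc.IH n_ge_2 by simp
    then show ?case using step Suc.prems(2) zero by (cases "r = 0") auto
  qed
qed

section \<open>The string O[m - 1, 0] and its complement\<close>

abbreviation Z :: "nat set" where "Z \<equiv> Orb m n (m - 1) 0"

lemma add_m_inj:
  assumes "r < n" "r' < n" "(r + m) mod n = (r' + m) mod n"
  shows "r = r'"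
proof -
  have "[r = r'] (mod n)"
    using assms(3) cong_add_rcancel_nat[of r m r' n] unfolding cong_def by blast
  then show ?thesis using assms(1,2) unfolding cong_def by simp
qed

lemma last_step: "(n - 1 + m) mod n = m - 1"
proof -
  have "n - 1 + m = (m - 1) + n" using m_pos n_ge_2 by simp
  then have "(n - 1 + m) mod n = (m - 1) mod n" by (simp only: mod_add_self2)
  then show ?thesis using m_less by simp
qed

text \<open>Unfolds the \<open>LEAST\<close> inside \<open>Orb\<close>: the string is a walk from m
  - 1, stopped at its first visit to 0. The later facts about \<open>Z\<close> rest on this
  form.\<close>

lemma Z_string:
  "\<exists>k a. a 0 = m - 1 \<and> a k = 0 \<and> (\<forall>j<k. a j \<noteq> 0) \<and> (\<forall>j. a (Suc j) = (a j + m) mod n)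
     \<and> (\<forall>j. a j < n) \<and> Z = a ` {..k}"
proof -
  define a where "a j = (m - 1 + j * m) mod n" for j
  define k where "k = (LEAST k. a k = 0)"
  have "\<exists>k. a k = 0"
    using edge_reach[of "m - 1" 0] m_pos m_less unfolding a_def by auto
  then have "a k = 0" unfolding k_def by (rule LeastI_ex)
  moreover have "a 0 = m - 1" using m_less unfolding a_def by simp
  moreover have "\<forall>j<k. a j \<noteq> 0" using not_less_Least unfolding k_def by blast
  moreover have "\<forall>j. a (Suc j) = (a j + m) mod n"
    unfolding a_def by (simp only: mod_add_left_eq) (simp add: algebra_simps)
  moreover have "\<forall>j. a j < n" using n_ge_2 unfolding a_def by simp
  moreover have "Z = a ` {..k}" unfolding Orb_def Let_def k_def a_def by auto
  ultimately show ?thesis by blast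
qed

lemma zero_in_Z: "0 \<in> Z"
  using Z_string by (metis atMost_iff image_eqI order_refl)

lemma head_in_Z: "m - 1 \<in> Z"
  using Z_string by (metis atMost_iff image_eqI zero_le)

lemma last_notin_Z: "n - 1 \<notin> Z"
proof
  assume a: "n - 1 \<in> Z"
  obtain k a where ka: "a 0 = m - 1" "a k = 0" "\<forall>j<k. a j \<noteq> 0" "\<forall>j. a (Suc j) = (a j + m) mod n"
    "Z = a ` {..k}"
    using Z_string by blast
  obtain j where j: "j \<le> k" "a j = n - 1" using a ka(5) by auto
  have "j \<noteq> k" using j(2) ka(2) n_ge_2 by auto
  then have lt: "j < k" using j(1) by simp
  \<comment> \<open>As n - 1 rotates to m - 1, which is \<open>a 0\<close>, a visit to n - 1 at time
    j would make the walk repeat with period j + 1, and the zero at time k would have an earlier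
    copy.\<close>
  have "a (Suc j + i) = a i" for i
  proof (induction i)
    case 0
    then show ?case using ka(1,4) j(2) last_step by simp
  next
    case (Suc i)
    then show ?case using ka(4) by simp
  qed
  from this[of "k - Suc j"] have "a (k - Suc j) = 0" using lt ka(2) by simp
  then show False using ka(3) lt by simp
qed

text \<open>Only e_0 rotates to e_m, and the walk stops at e_0; nor does it start at e_m.\<close>

lemma m_notin_Z: "m \<notin> Z"
proof
  assume a: "m \<in> Z"
  obtain k a where ka: "a 0 = m - 1" "\<forall>j<k. a j \<noteq> 0" "\<forall>j. a (Suc j) = (a j + m) mod n"
    "\<forall>j. a j < n" "Z = a ` {..k}"
    using Z_string by blast
  obtain j where j: "j \<le> k" "a j = m" using a ka(5) by auto
  show False
  proof (cases j)
    case 0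
    then show False using j ka(1) m_pos by simp
  next
    case (Suc i)
    have "a i = 0"
      using add_m_inj[of 0 "a i"] ka(3,4) j(2) Suc m_less n_ge_2 by simp
    then show False using ka(2) j(1) Suc by simp
  qed
qed

text \<open>The two strings end at 0 and n - 1. Only from there does a rotation switch sides: 0 goes
  to m outside \<open>Z\<close>, and n - 1 goes to m - 1 inside.\<close>

lemma Z_step:
  assumes "r < n" "r \<noteq> 0" "r \<noteq> n - 1"
  shows "(r + m) mod n \<in> Z \<longleftrightarrow> r \<in> Z"
proof -
  obtain k a where ka: "a 0 = m - 1" "a k = 0" "\<forall>j<k. a j \<noteq> 0" "\<forall>j. a (Suc j) = (a j + m) mod n"
    "\<forall>j. a j < n" "Z = a ` {..k}"
    using Z_string by blast
  show ?thesis
  proof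
    assume "r \<in> Z"
    then obtain j where j: "j \<le> k" "r = a j" using ka(6) by auto
    then have "j \<noteq> k" using ka(2) assms(2) by auto
    then have "Suc j \<le> k" using j(1) by simp
    then show "(r + m) mod n \<in> Z" using ka(4,6) j(2) by (metis atMost_iff image_eqI)
  next
    assume "(r + m) mod n \<in> Z"
    then obtain j where j: "j \<le> k" "(r + m) mod n = a j" using ka(6) by auto
    show "r \<in> Z"
    proof (cases j)
      case 0
      then have "r = n - 1"
        using add_m_inj[of r "n - 1"] assms(1) j(2) ka(1) last_step n_ge_2 by simp
      then show ?thesis using assms(3) by simp
    next
      case (Suc i)
      then have "r = a i" using add_m_inj[of r "a i"] ka(4,5) j(2) assms(1) by simp
      then show ?thesis using ka(6) j(1) Suc by simp
    qed
  qed
qed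

text \<open>Walk around the star from n - 1, which lies outside \<open>Z\<close>, so that the
  conditional claim is vacuous at first; \<open>Z\<close> is entered only at m - 1. The dual rule
  for the complement starts at 0 instead.\<close>

lemma Z_forward_induct [consumes 2, case_names head step]:
  assumes "r \<in> Z" "r < n" and head: "Q (m - 1)"
    and step: "\<And>r. 0 < r \<Longrightarrow> r < n - 1 \<Longrightarrow> r \<in> Z \<Longrightarrow> Q r \<Longrightarrow> Q ((r + m) mod n)"
  shows "Q r"
proof -
  have "r \<in> Z \<longrightarrow> Q r"
  proof (rule forward_induct[of "n - 1" r])
    fix r assume r: "r < n" "r \<in> Z \<longrightarrow> Q r"
    consider "r = 0" | "r = n - 1" | "0 < r" "r < n - 1" using r(1) by linarith
    then show "(r + m) mod n \<in> Z \<longrightarrow> Q ((r + m) mod n)"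
    proof cases
      case 1
      then show ?thesis using m_notin_Z m_less by simp
    next
      case 2
      then show ?thesis using head last_step by simp
    next
      case 3
      then show ?thesis using Z_step[of r] step[of r] r by auto
    qed
  qed (use last_notin_Z n_ge_2 assms(2) in auto)
  then show ?thesis using assms(1) by blast
qed

lemma notin_Z_forward_induct [consumes 2, case_names head step]:
  assumes "r \<notin> Z" "r < n" and head: "Q m"
    and step: "\<And>r. 0 < r \<Longrightarrow> r < n - 1 \<Longrightarrow> r \<notin> Z \<Longrightarrow> Q r \<Longrightarrow> Q ((r + m) mod n)"
  shows "Q r"
proof -
  have "r \<notin> Z \<longrightarrow> Q r"
  proof (rule forward_induct[of 0 r])
    fix r assume r: "r < n" "r \<notin> Z \<longrightarrow> Q r"
    consider "r = 0" | "r = n - 1" | "0 < r" "r < n - 1" using r(1) by linarith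
    then show "(r + m) mod n \<notin> Z \<longrightarrow> Q ((r + m) mod n)"
    proof cases
      case 1
      then show ?thesis using head m_less by simp
    next
      case 2
      then show ?thesis using head_in_Z last_step by simp
    next
      case 3
      then show ?thesis using Z_step[of r] step[of r] r by auto
    qed
  qed (use zero_in_Z n_ge_2 assms(2) in auto)
  then show ?thesis using assms(1) by blast
qed

end

section \<open>The zigzag map on the distinguished edge\<close>

definition piece :: "nat \<Rightarrow> real \<Rightarrow> nat" where
  "piece m t = nat \<lfloor>real (2 * m + 1) * t\<rfloor>"

text \<open>On an odd piece with fractional part 0 the value is 1 and not 0: such a point goes to
  the vertex, whose coordinate is 1, and \<open>mkpt\<close> recognises it by this value.\<close>

definition zig :: "nat \<Rightarrow> real \<Rightarrow> real" where
  "zig m t = (if even (piece m t) then frac (real (2 * m + 1) * t)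
              else 1 - frac (real (2 * m + 1) * t))"

lemma fmap_zero: "t < 1 \<Longrightarrow> fmap m n (0, t) = mkpt ((piece m t + 1) div 2) (zig m t)"
  using frac_lt_1[of "real (2 * m + 1) * t"]
  by (auto simp: fmap_def piece_def zig_def Let_def mkpt_def frac_def)

lemma fmap_nonzero: "r \<noteq> 0 \<Longrightarrow> t < 1 \<Longrightarrow> fmap m n (r, t) = ((r + m) mod n, t)"
  by (simp add: fmap_def)

lemma zig_bounds: "0 \<le> zig m t" "zig m t \<le> 1"
  using frac_lt_1[of "real (2 * m + 1) * t"] frac_ge_0[of "real (2 * m + 1) * t"]
  by (auto simp: zig_def)

lemma piece_le:
  assumes "t < 1"
  shows "piece m t \<le> 2 * m"
proof -
  have "real (2 * m + 1) * t < real (2 * m + 1)"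
    using assms by simp
  then have "\<lfloor>real (2 * m + 1) * t\<rfloor> < int (2 * m + 1)"
    by (simp add: floor_less_iff)
  then show ?thesis by (simp add: piece_def)
qed

lemma piece_zig:
  assumes "0 \<le> t"
  shows "real (2 * m + 1) * t = piece m t + (if even (piece m t) then zig m t else 1 - zig m t)"
proof -
  have "0 \<le> real (2 * m + 1) * t" using assms by simp
  then have "0 \<le> \<lfloor>real (2 * m + 1) * t\<rfloor>" by simp
  then have "real (piece m t) = of_int \<lfloor>real (2 * m + 1) * t\<rfloor>"
    by (simp add: piece_def)
  then show ?thesis by (simp add: zig_def frac_def)
qed

lemma piece_zig_eqI:
  assumes "0 < y" "y < 1" "real (2 * m + 1) * t = d + (if even d then y else 1 - y)"
  shows "piece m t = d" "zig m t = y"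
proof -
  have "\<lfloor>real (2 * m + 1) * t\<rfloor> = int d"
    unfolding assms(3) using assms(1,2) by (intro floor_unique) auto
  then show "piece m t = d" by (simp add: piece_def)
  with \<open>\<lfloor>real (2 * m + 1) * t\<rfloor> = int d\<close> assms(3) show "zig m t = y"
    by (auto simp: zig_def frac_def)
qed

lemma piece_mono: "s \<le> t \<Longrightarrow> piece m s \<le> piece m t"
  unfolding piece_def by (intro nat_mono floor_mono mult_left_mono) auto

lemma piece_locally_constant:
  assumes "0 \<le> t" "t < 1" "0 < zig m t" "zig m t < 1"
  obtains \<epsilon> where "0 < \<epsilon>" "0 < t - \<epsilon>" "t + \<epsilon> < 1"
    "\<And>t'. \<bar>t' - t\<bar> < \<epsilon> \<Longrightarrow> piece m t' = piece m t \<and> 0 < zig m t' \<and> zig m t' < 1"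
proof -
  define d where "d = piece m t"
  define w where "w = (if even d then zig m t else 1 - zig m t)"
  define M where "M = real (2 * m + 1)"
  have M: "1 \<le> M" by (simp add: M_def)
  have w: "0 < w" "w < 1" using assms by (auto simp: w_def)
  have Mt: "M * t = d + w"
    using piece_zig[OF assms(1), of m] unfolding M_def d_def w_def by simp
  have d: "real d + 1 \<le> M"
    using piece_le[OF assms(2), of m] unfolding M_def d_def by simp
  \<comment> \<open>Multiplied by \<open>M\<close>, this radius is half the distance from
    \<open>w\<close> to {0, 1}, so the piece cannot change within it.\<close>
  define \<epsilon> where "\<epsilon> = min w (1 - w) / 2 / M"
  have \<epsilon>: "M * \<epsilon> = min w (1 - w) / 2"
    using M by (simp add: \<epsilon>_def)
  have pos: "0 < \<epsilon>" using w M by (simp add: \<epsilon>_def)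
  have \<epsilon>': "M * \<epsilon> < w" "M * \<epsilon> < 1 - w"
    unfolding \<epsilon> using w by (auto simp: min_def field_simps)
  have "0 < M * (t - \<epsilon>)"
    unfolding right_diff_distrib Mt using \<epsilon>'(1) by simp
  then have 1: "0 < t - \<epsilon>" using M by (simp add: zero_less_mult_iff)
  have "M * (t + \<epsilon>) < M * 1"
    unfolding distrib_left Mt using \<epsilon>'(2) d by simp
  then have 2: "t + \<epsilon> < 1" using M by (simp add: mult_less_cancel_left_pos del: mult_1_right)
  have 3: "piece m t' = piece m t \<and> 0 < zig m t' \<and> zig m t' < 1" if "\<bar>t' - t\<bar> < \<epsilon>" for t'
  proof -
    define w' where "w' = M * t' - d"
    have "\<bar>M * (t' - t)\<bar> < min w (1 - w) / 2"
      using that M unfolding \<epsilon>[symmetric] by (simp add: abs_mult)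
    moreover have "M * (t' - t) = w' - w"
      using Mt by (simp add: w'_def right_diff_distrib)
    ultimately have w': "0 < w'" "w' < 1"
      using w by (auto simp: min_def abs_real_def split: if_splits)
    have "real (2 * m + 1) * t' = d + (if even d then (if even d then w' else 1 - w')
        else 1 - (if even d then w' else 1 - w'))"
      by (simp add: w'_def M_def)
    from piece_zig_eqI[OF _ _ this] w' show ?thesis
      by (auto simp: d_def)
  qed
  show ?thesis using that[OF pos 1 2 3] .
qed

section \<open>Periodic orbits\<close>

lemma periodic_range:
  assumes per: "0 < p" "(f ^^ p) x = x" and X: "X = range (\<lambda>i. (f ^^ i) x)"
  shows "finite X" "f ` X = X" "inj_on f X"
    "\<And>y z. y \<in> X \<Longrightarrow> z \<in> X \<Longrightarrow> \<exists>i. (f ^^ i) y = z"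
proof -
  have per_mult: "(f ^^ (k * p)) x = x" for k
    by (induction k) (simp_all add: funpow_add per(2))
  have mod: "(f ^^ i) x = (f ^^ (i mod p)) x" for i
  proof -
    have "(f ^^ i) x = (f ^^ (i mod p + i div p * p)) x" by (simp only: mod_div_mult_eq)
    then show ?thesis by (simp only: funpow_add o_apply per_mult)
  qed
  have "X \<subseteq> (\<lambda>i. (f ^^ i) x) ` {..<p}"
  proof
    fix y assume "y \<in> X"
    then obtain i where "y = (f ^^ i) x" using X by blast
    then have "y = (f ^^ (i mod p)) x" using mod by metis
    then show "y \<in> (\<lambda>i. (f ^^ i) x) ` {..<p}" using per(1) by auto
  qed
  then show fin: "finite X" using finite_subset by blast
  show surj: "f ` X = X"
  proof
    show "f ` X \<subseteq> X"
    proof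
      fix y assume "y \<in> f ` X"
      then obtain i where "y = f ((f ^^ i) x)" using X by blast
      then have "y = (f ^^ Suc i) x" by simp
      then show "y \<in> X" using X by blast
    qed
    show "X \<subseteq> f ` X"
    proof
      fix y assume "y \<in> X"
      then obtain i where "y = (f ^^ i) x" using X by blast
      moreover have "(f ^^ (i + p)) x = (f ^^ i) x" by (simp add: funpow_add per(2))
      moreover have "(f ^^ (i + p)) x = f ((f ^^ (i + p - 1)) x)"
        using per(1) by (metis Suc_diff_1 add_gr_0 comp_apply funpow.simps(2))
      moreover have "(f ^^ (i + p - 1)) x \<in> X" unfolding X by (rule rangeI)
      ultimately show "y \<in> f ` X" by (intro image_eqI[of _ _ "(f ^^ (i + p - 1)) x"]) simp_all
    qed
  qed
  show "inj_on f X" using fin surj by (simp add: eq_card_imp_inj_on)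
  fix y z assume "y \<in> X" "z \<in> X"
  then obtain i j where ij: "y = (f ^^ i) x" "z = (f ^^ j) x" using X by blast
  \<comment> \<open>From the i-th iterate, i * p - i further steps complete i whole periods and
    return to x; another j steps reach z.\<close>
  have "i \<le> i * p" using per(1) by simp
  then have "(f ^^ (j + (i * p - i))) y = (f ^^ (j + (i * p - i) + i)) x"
    unfolding ij(1) by (simp only: funpow_add o_apply)
  also have "j + (i * p - i) + i = j + i * p" using \<open>i \<le> i * p\<close> by (simp only: add.assoc le_add_diff_inverse2)
  also have "(f ^^ (j + i * p)) x = z" by (simp only: funpow_add o_apply per_mult ij(2))
  finally show "\<exists>i. (f ^^ i) y = z" by blast
qed

definition tail :: "nat \<Rightarrow> real set \<Rightarrow> real set" where
  "tail m X = zig m ` {t \<in> X. 2 * m \<le> piece m t + 1}"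

text \<open>
  The traces on \<open>e\<^sub>0\<close> of the orbits in \<open>P(m/n, m - 1, B)\<close>. The last condition encodes
  \<open>f(p\<^bsub>n-1\<^esub>) = p\<^bsub>m-1\<^esub>\<close>. Bounds on pieces are written without subtraction.
\<close>
definition admissible :: "nat \<Rightarrow> real set \<Rightarrow> bool" where
  "admissible m X \<longleftrightarrow> (\<exists>x p. 0 < p \<and> (zig m ^^ p) x = x \<and> X = range (\<lambda>i. (zig m ^^ i) x))
     \<and> X \<subseteq> {0<..<1} \<and> (\<forall>t\<in>X. 2 * m \<le> piece m t + 2) \<and> (\<exists>t\<in>X. piece m t + 2 = 2 * m)
     \<and> Min X \<in> tail m X"

locale admissible_orbit =
  fixes m :: nat and X :: "real set"
  assumes pos_m: "0 < m" and adm: "admissible m X"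
begin

lemma finite_X: "finite X" and zig_image: "zig m ` X = X" and zig_inj: "inj_on (zig m) X"
  and zig_reach: "\<And>y z. y \<in> X \<Longrightarrow> z \<in> X \<Longrightarrow> \<exists>i. (zig m ^^ i) y = z"
proof -
  obtain x p where "0 < p" "(zig m ^^ p) x = x" "X = range (\<lambda>i. (zig m ^^ i) x)"
    using adm unfolding admissible_def by blast
  note per = periodic_range[OF this]
  show "finite X" "zig m ` X = X" "inj_on (zig m) X" by (fact per(1) per(2) per(3))+
  fix y z assume "y \<in> X" "z \<in> X"
  then show "\<exists>i. (zig m ^^ i) y = z" by (rule per(4))
qed

lemma X_bounds: "t \<in> X \<Longrightarrow> 0 < t" "t \<in> X \<Longrightarrow> t < 1"
  using adm unfolding admissible_def by auto

lemma zig_in_X: "t \<in> X \<Longrightarrow> zig m t \<in> X"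
  using zig_image by blast

lemma piece_cases: "t \<in> X \<Longrightarrow> piece m t + 2 = 2 * m \<or> piece m t + 1 = 2 * m \<or> piece m t = 2 * m"
proof -
  assume "t \<in> X"
  then have "2 * m \<le> piece m t + 2" "piece m t \<le> 2 * m"
    using adm piece_le[OF X_bounds(2)] unfolding admissible_def by simp_all
  then show ?thesis by linarith
qed

lemma ex_low: "\<exists>t\<in>X. piece m t + 2 = 2 * m"
  using adm unfolding admissible_def by blast

lemma X_nonempty: "X \<noteq> {}"
  using ex_low by blast

lemma tail_subset: "tail m X \<subseteq> X"
  using zig_image unfolding tail_def by blast

lemma Min_in_tail: "Min X \<in> tail m X"
  using adm unfolding admissible_def by blast

lemma finite_tail: "finite (tail m X)"
  using tail_subset finite_X finite_subset by blast

lemma Min_tail: "Min (tail m X) = Min X"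
  using Min_in_tail finite_tail tail_subset finite_X by (intro Min_eqI) auto

lemma ex_high: "\<exists>t\<in>X. 2 * m \<le> piece m t + 1"
  using Min_in_tail unfolding tail_def by blast

lemma Min_low: "piece m (Min X) + 2 = 2 * m"
proof -
  obtain t where t: "t \<in> X" "piece m t + 2 = 2 * m" using ex_low by blast
  have "piece m (Min X) \<le> piece m t" using t finite_X by (intro piece_mono) simp
  moreover have "Min X \<in> X" using finite_X X_nonempty by simp
  ultimately show ?thesis using t(2) piece_cases[of "Min X"] by linarith
qed

lemma zig_eq_Min_high:
  assumes "t \<in> X" "zig m t = Min X"
  shows "2 * m \<le> piece m t + 1"
proof -
  obtain u where "u \<in> X" "2 * m \<le> piece m u + 1" "zig m u = Min X"
    using Min_in_tail unfolding tail_def by auto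
  then show ?thesis using zig_inj assms by (metis inj_onD)
qed

text \<open>The preimage of \<open>Min X\<close> lies in one of the last two pieces,
  \<open>Min X\<close> itself in the one before them, so \<open>Min X\<close> is not fixed. This is
  why the first point gets label B and not C.\<close>

lemma zig_Min_greater: "Min X < zig m (Min X)"
proof -
  have M: "Min X \<in> X" using finite_X X_nonempty by simp
  have "zig m (Min X) \<noteq> Min X" using zig_eq_Min_high[OF M] Min_low by auto
  moreover have "Min X \<le> zig m (Min X)" using zig_in_X[OF M] finite_X by simp
  ultimately show ?thesis by simp
qed

end

section \<open>Transporting orbits between zigzag maps\<close>

text \<open>The solution is the series obtained by unrolling h = (c + s * (h o T)) / M. It converges
  because M > 1, while \<open>c\<close> is bounded and the products of the factors \<open>s\<close>
  have modulus at most 1.\<close>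

lemma contraction_equation:
  fixes c s :: "'a \<Rightarrow> real" and M :: real
  assumes T: "\<And>x. x \<in> X \<Longrightarrow> T x \<in> X" and c: "\<And>x. x \<in> X \<Longrightarrow> \<bar>c x\<bar> \<le> K"
    and s: "\<And>x. x \<in> X \<Longrightarrow> \<bar>s x\<bar> \<le> 1" and M: "1 < M"
  shows "\<exists>h. \<forall>x\<in>X. M * h x = c x + s x * h (T x)"
proof -
  define a where "a x k = (\<Prod>i<k. s ((T ^^ i) x)) * c ((T ^^ k) x) / M ^ Suc k" for x k
  have orb: "(T ^^ i) x \<in> X" if "x \<in> X" for x i
    using that T by (induction i) auto
  have summ: "summable (a x)" if "x \<in> X" for x
  proof (rule summable_comparison_test')
    show "summable (\<lambda>k. K / M * (1 / M) ^ k)"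
      using M by (intro summable_mult summable_geometric) auto
    fix k
    have "(\<Prod>i<k. \<bar>s ((T ^^ i) x)\<bar>) \<le> 1"
      using s orb[OF that] by (intro prod_le_1) auto
    then have "(\<Prod>i<k. \<bar>s ((T ^^ i) x)\<bar>) * \<bar>c ((T ^^ k) x)\<bar> \<le> 1 * K"
      using c orb[OF that] by (intro mult_mono) auto
    then have "(\<Prod>i<k. \<bar>s ((T ^^ i) x)\<bar>) * \<bar>c ((T ^^ k) x)\<bar> / M ^ Suc k \<le> K / M ^ Suc k"
      using M by (intro divide_right_mono) auto
    then show "norm (a x k) \<le> K / M * (1 / M) ^ k"
      using M by (simp add: a_def abs_mult abs_prod power_one_over field_simps)
  qed
  have "M * suminf (a x) = c x + s x * suminf (a (T x))" if "x \<in> X" for x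
  proof -
    have "a x (Suc k) = s x / M * a (T x) k" for k
      unfolding a_def
      by (subst prod.lessThan_Suc_shift) (simp add: funpow_swap1 funpow_Suc_right del: funpow.simps)
    then have "(\<Sum>k. a x (Suc k)) = s x / M * suminf (a (T x))"
      using suminf_mult[OF summ[OF T[OF that]], of "s x / M"] by simp
    then have "suminf (a x) = a x 0 + s x / M * suminf (a (T x))"
      using suminf_split_head[OF summ[OF that]] by simp
    then show ?thesis using M by (simp add: a_def field_simps)
  qed
  then show ?thesis by (intro exI[of _ "\<lambda>x. suminf (a x)"] ballI)
qed

text \<open>Pieces are matched by counting from the central vertex. The index shift 2 * m' - 2 * m,
  written without subtraction, is even, so both maps have the same orientation at matched
  points.\<close>

definition conjugates :: "nat \<Rightarrow> nat \<Rightarrow> real set \<Rightarrow> (real \<Rightarrow> real) \<Rightarrow> bool" where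
  "conjugates m m' X h \<longleftrightarrow> (\<forall>x\<in>X. \<forall>y\<in>X. x < y \<longrightarrow> h x < h y)
     \<and> (\<forall>t\<in>X. piece m' (h t) + 2 * m = piece m t + 2 * m' \<and> zig m' (h t) = h (zig m t))"

lemma same_piece_expands:
  assumes "0 \<le> x" "0 \<le> y" "piece m x = piece m y"
  shows "\<bar>zig m x - zig m y\<bar> = real (2 * m + 1) * \<bar>x - y\<bar>"
proof -
  have "real (2 * m + 1) * \<bar>x - y\<bar> = \<bar>real (2 * m + 1) * x - real (2 * m + 1) * y\<bar>"
    by (simp only: abs_mult abs_of_nat flip: right_diff_distrib)
  then show ?thesis
    unfolding piece_zig[OF assms(1)] piece_zig[OF assms(2)] assms(3) by auto
qed

section \<open>Separation by itineraries and construction of the conjugacy\<close>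

context admissible_orbit
begin

lemma zig_iter_in_X: "t \<in> X \<Longrightarrow> (zig m ^^ i) t \<in> X"
  using zig_in_X by (induction i) auto

text \<open>As long as the itineraries agree, each step multiplies the distance by 2 * m + 1, yet
  two points of X are always less than 1 apart.\<close>

lemma pieces_separate:
  assumes "x \<in> X" "y \<in> X" "x \<noteq> y"
  shows "\<exists>k. piece m ((zig m ^^ k) x) \<noteq> piece m ((zig m ^^ k) y)"
proof (rule ccontr)
  assume "\<not> ?thesis"
  then have same: "piece m ((zig m ^^ k) x) = piece m ((zig m ^^ k) y)" for k by simp
  have bds: "0 < (zig m ^^ k) t" "(zig m ^^ k) t < 1" if "t \<in> X" for t k
    using X_bounds zig_iter_in_X[OF that] by auto
  have "\<bar>(zig m ^^ k) x - (zig m ^^ k) y\<bar> = real (2 * m + 1) ^ k * \<bar>x - y\<bar>" for k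
  proof (induction k)
    case (Suc k)
    then show ?case
      using same_piece_expands[OF _ _ same[of k]] bds(1)[OF assms(1), of k] bds(1)[OF assms(2), of k]
      by simp
  qed simp
  moreover have "\<bar>(zig m ^^ k) x - (zig m ^^ k) y\<bar> < 1" for k
    using bds[OF assms(1), of k] bds[OF assms(2), of k] by (simp add: abs_real_def)
  ultimately have "real (2 * m + 1) ^ k * \<bar>x - y\<bar> < 1" for k by simp
  moreover obtain k where "1 / \<bar>x - y\<bar> < real (2 * m + 1) ^ k"
    using real_arch_pow[of "real (2 * m + 1)"] pos_m by auto
  ultimately show False using assms(3) by (simp add: field_simps) (metis not_less_iff_gr_or_eq)
qed

text \<open>
  The value \<open>h t\<close> is the point whose itinerary under the other zigzag map is the shifted itinerary
  of \<open>t\<close>; it is monotone because both maps expand and have the same orientations on the pieces used.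
\<close>
lemma transport:
  assumes "0 < m'"
  obtains h where "conjugates m m' X h" "admissible m' (h ` X)"
proof -
  define D where "D t = piece m t + 2 * m' - 2 * m" for t
  have D: "D t + 2 * m = piece m t + 2 * m'" "D t \<le> 2 * m'" if "t \<in> X" for t
    using piece_cases[OF that] assms unfolding D_def by linarith+
  have even_D: "even (D t) \<longleftrightarrow> even (piece m t)" if "t \<in> X" for t
    using D(1)[OF that] by presburger
  define M where "M = real (2 * m' + 1)"
  \<comment> \<open>This is \<open>piece_zig\<close> with \<open>h x\<close> as the point,
    \<open>D x\<close> as its piece and \<open>h (zig m x)\<close> as its image. For odd
    \<open>D x\<close> the constant 1 is moved into the first summand to obtain the shape c + s *
    h.\<close>
  have "\<exists>h :: real \<Rightarrow> real. \<forall>x\<in>X. M * h x = real (if even (D x) then D x else D x + 1)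
      + (if even (D x) then 1 else - 1 :: real) * h (zig m x)"
  proof (rule contraction_equation[of X "zig m" _ "real (2 * m' + 1)"])
    show "\<bar>real (if even (D x) then D x else D x + 1)\<bar> \<le> real (2 * m' + 1)" if "x \<in> X" for x
      using D(2)[OF that] by simp
  qed (use assms zig_in_X in \<open>auto simp: M_def\<close>)
  then obtain h where "\<forall>x\<in>X. M * h x = real (if even (D x) then D x else D x + 1)
      + (if even (D x) then 1 else - 1 :: real) * h (zig m x)" by (elim exE)
  then have h: "M * h x = D x + (if even (D x) then h (zig m x) else 1 - h (zig m x))" if "x \<in> X" for x
    using that by (auto split: if_splits)

  \<comment> \<open>Centred at 1/2 the equation becomes symmetric: M * (h x - 1/2) has modulus at
    most m' + \<delta>, because \<open>D x\<close> lies between 0 and 2 * m'. With M = 2 * m' + 1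
    this forces \<delta> \<le> 1/2.\<close>
  define \<delta> where "\<delta> = Max ((\<lambda>x. \<bar>h x - 1/2\<bar>) ` X)"
  have le: "\<bar>h x - 1/2\<bar> \<le> \<delta>" if "x \<in> X" for x
    unfolding \<delta>_def using that finite_X by simp
  have "\<delta> \<in> (\<lambda>x. \<bar>h x - 1/2\<bar>) ` X"
    unfolding \<delta>_def using finite_X X_nonempty by (intro Max_in) auto
  then obtain x where x: "x \<in> X" "\<delta> = \<bar>h x - 1/2\<bar>" by blast
  have "M * (h x - 1/2) = (real (D x) - real m')
      + (if even (D x) then 1 else - 1) * (h (zig m x) - 1/2)"
    using h[OF x(1)] by (auto simp: M_def algebra_simps)
  then have "\<bar>M * (h x - 1/2)\<bar> \<le> \<bar>real (D x) - real m'\<bar> + \<bar>h (zig m x) - 1/2\<bar>"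
    by (auto split: if_splits)
  also have "\<dots> \<le> real m' + \<delta>"
    using D(2)[OF x(1)] le[OF zig_in_X[OF x(1)]] by (intro add_mono) (auto simp: abs_real_def)
  finally have "M * \<delta> \<le> real m' + \<delta>" unfolding x(2) by (simp add: abs_mult M_def)
  then have "real m' * (2 * \<delta>) \<le> real m' * 1" by (simp add: M_def algebra_simps)
  then have "\<delta> \<le> 1/2" using assms by simp
  then have bounds: "0 \<le> h x" "h x \<le> 1" if "x \<in> X" for x
    using le[OF that] by (auto simp: abs_real_def split: if_splits)

  have iter: "Q y" if "x \<in> X" "y \<in> X" "Q x" "\<And>x. x \<in> X \<Longrightarrow> Q x \<Longrightarrow> Q (zig m x)" for Q x y
  proof -
    have "Q ((zig m ^^ i) x)" for i
      using that zig_iter_in_X[OF that(1)] by (induction i) auto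
    then show ?thesis using zig_reach[OF that(1,2)] by auto
  qed
  \<comment> \<open>A value 0 would propagate around the cycle and give every point the new piece 0,
    against the presence of a point in the last two pieces. The value 1 is excluded in the same way
    by a point in the lowest of the three.\<close>
  have zero: "D x = 0 \<and> h (zig m x) = 0" if "x \<in> X" "h x = 0" for x
    using h[OF that(1)] that(2) bounds[OF zig_in_X[OF that(1)]] by (cases "D x") (auto split: if_splits)
  have pos: "0 < h x" if x: "x \<in> X" for x
  proof (rule ccontr)
    assume "\<not> 0 < h x"
    then have "h x = 0" using bounds[OF x] by simp
    then have all: "h y = 0" if "y \<in> X" for y
      by (rule iter[OF x that]) (use zero in blast)
    obtain y where y: "y \<in> X" "2 * m \<le> piece m y + 1" using ex_high by blast
    then show False using zero[OF y(1) all[OF y(1)]] D(1)[OF y(1)] assms by linarith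
  qed
  have one: "D x = 2 * m' \<and> h (zig m x) = 1" if "x \<in> X" "h x = 1" for x
  proof -
    have "real (2 * m' + 1) = D x + (if even (D x) then h (zig m x) else 1 - h (zig m x))"
      using h[OF that(1)] that(2) by (simp add: M_def)
    moreover have "0 < h (zig m x)" "h (zig m x) \<le> 1"
      using pos bounds zig_in_X that(1) by auto
    ultimately show ?thesis using D(2)[OF that(1)] by (cases "D x = 2 * m'") (auto split: if_splits)
  qed
  have lt_one: "h x < 1" if x: "x \<in> X" for x
  proof (rule ccontr)
    assume "\<not> h x < 1"
    then have "h x = 1" using bounds[OF x] by simp
    then have all: "h y = 1" if "y \<in> X" for y
      by (rule iter[OF x that]) (use one in blast)
    obtain y where y: "y \<in> X" "piece m y + 2 = 2 * m" using ex_low by blast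
    then show False using one[OF y(1) all[OF y(1)]] D(1)[OF y(1)] assms by linarith
  qed

  have pz: "piece m' (h t) = D t" "zig m' (h t) = h (zig m t)" if "t \<in> X" for t
    using piece_zig_eqI[of "h (zig m t)" m' "h t" "D t"] pos lt_one zig_in_X that h[OF that]
    by (auto simp: M_def)
  have less_D: "h x < h y" if "x \<in> X" "y \<in> X" "D x < D y" for x y
  proof -
    have "M * h x < D x + 1" "D y < M * h y"
      using h[OF that(1)] h[OF that(2)] pos[OF zig_in_X[OF that(1)]] lt_one[OF zig_in_X[OF that(1)]]
        pos[OF zig_in_X[OF that(2)]] lt_one[OF zig_in_X[OF that(2)]] by auto
    moreover have "real (D x) + 1 \<le> D y" using that(3) by simp
    ultimately have "M * h x < M * h y" by linarith
    then show ?thesis by (simp add: M_def)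
  qed
  \<comment> \<open>Induction on a time k at which the itineraries differ. While the pieces agree,
    compare the images instead; an odd piece reverses the order for both maps, hence the claim is
    kept general in x and y.\<close>
  have mono_aux: "h x < h y" if "x \<in> X" "y \<in> X" "x < y"
    "piece m ((zig m ^^ k) x) \<noteq> piece m ((zig m ^^ k) y)" for k x y
    using that
  proof (induction k arbitrary: x y)
    case 0
    then have "piece m x < piece m y" using piece_mono[of x y m] by simp
    then show ?case using less_D D(1) 0 by (metis add_less_cancel_right)
  next
    case (Suc k)
    show ?case
    proof (cases "piece m x = piece m y")
      case False
      then have "piece m x < piece m y" using piece_mono[of x y m] Suc.prems(3) by simp
      then show ?thesis using less_D D(1) Suc.prems by (metis add_less_cancel_right)
    next
      case same: True
      have xy: "0 < x" "0 < y" using X_bounds Suc.prems by auto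
      have "real (2 * m + 1) * x < real (2 * m + 1) * y" using Suc.prems(3) by simp
      then have less: "if even (piece m x) then zig m x < zig m y else zig m y < zig m x"
        unfolding piece_zig[OF less_imp_le[OF xy(1)]] piece_zig[OF less_imp_le[OF xy(2)]] same
        by (auto split: if_splits)
      have eq: "D x = D y" using same by (simp add: D_def)
      have sep: "piece m ((zig m ^^ k) (zig m x)) \<noteq> piece m ((zig m ^^ k) (zig m y))"
        using Suc.prems(4) by (simp add: funpow_swap1)
      have "M * h x < M * h y"
      proof (cases "even (piece m x)")
        case True
        then have "h (zig m x) < h (zig m y)"
          using Suc.IH[OF zig_in_X zig_in_X _ sep] Suc.prems less by simp
        then show ?thesis using h Suc.prems eq even_D True same by auto
      next
        case False
        then have "h (zig m y) < h (zig m x)"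
          using Suc.IH[OF zig_in_X zig_in_X _ sep[symmetric]] Suc.prems less by simp
        then show ?thesis using h Suc.prems eq even_D False same by auto
      qed
      then show ?thesis by (simp add: M_def)
    qed
  qed
  have mono: "h x < h y" if "x \<in> X" "y \<in> X" "x < y" for x y
    using pieces_separate[OF that(1,2)] mono_aux[OF that] that(3) by auto
  have conj: "conjugates m m' X h"
    unfolding conjugates_def using mono pz D(1) by simp

  obtain x p where xp: "0 < p" "(zig m ^^ p) x = x" "X = range (\<lambda>i. (zig m ^^ i) x)"
    using adm unfolding admissible_def by blast
  have x: "x \<in> X" unfolding xp(3) by (rule range_eqI[of _ _ 0]) simp
  have orbit: "(zig m' ^^ i) (h x) = h ((zig m ^^ i) x)" for i
    using pz(2) zig_iter_in_X[OF x] by (induction i) auto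
  have MinX: "Min X \<in> X" using finite_X X_nonempty by simp
  have Min_h: "Min (h ` X) = h (Min X)"
  proof (rule Min_eqI)
    fix y assume "y \<in> h ` X"
    then obtain t where t: "t \<in> X" "y = h t" by blast
    then have "Min X \<le> t" using finite_X by simp
    then show "h (Min X) \<le> y" using mono[OF MinX t(1)] t(2) by (cases "Min X = t") auto
  qed (use finite_X MinX in auto)
  have "admissible m' (h ` X)"
    unfolding admissible_def
  proof (intro conjI)
    show "\<exists>x p. 0 < p \<and> (zig m' ^^ p) x = x \<and> h ` X = range (\<lambda>i. (zig m' ^^ i) x)"
    proof (intro exI conjI)
      show "(zig m' ^^ p) (h x) = h x" using orbit xp(2) by simp
      show "h ` X = range (\<lambda>i. (zig m' ^^ i) (h x))"
        unfolding orbit by (subst xp(3)) (simp add: image_image)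
    qed (rule xp(1))
    show "h ` X \<subseteq> {0<..<1}" using pos lt_one by auto
    show "\<forall>t\<in>h ` X. 2 * m' \<le> piece m' t + 2"
      using D(1) piece_cases pz(1) by fastforce
    obtain t where t: "t \<in> X" "piece m t + 2 = 2 * m" using ex_low by blast
    have "piece m' (h t) + 2 = 2 * m'" using pz(1) D(1) t by fastforce
    then show "\<exists>t\<in>h ` X. piece m' t + 2 = 2 * m'" using t(1) by blast
    obtain u where u: "u \<in> X" "2 * m \<le> piece m u + 1" "zig m u = Min X"
      using Min_in_tail unfolding tail_def by auto
    have "2 * m' \<le> piece m' (h u) + 1" using pz(1)[OF u(1)] D(1)[OF u(1)] u(2) by linarith
    then show "Min (h ` X) \<in> tail m' (h ` X)"
      unfolding Min_h tail_def using pz(2)[OF u(1)] u(1,3) by (intro image_eqI[of _ _ "h u"]) auto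
  qed
  with conj show ?thesis using that by blast
qed

end

section \<open>Labels and local behaviour\<close>

definition rank :: "real set \<Rightarrow> real \<Rightarrow> nat" where
  "rank A t = card {t' \<in> A. t' < t}"

lemma rank_less:
  assumes "finite A" "s \<in> A" "s < t"
  shows "rank A s < rank A t"
  unfolding rank_def using assms by (intro psubset_card_mono) auto

lemma rank_inj:
  assumes "finite A"
  shows "inj_on (rank A) A"
proof (rule inj_onI)
  fix s t assume "s \<in> A" "t \<in> A" "rank A s = rank A t"
  then show "s = t" using rank_less[OF assms, of s t] rank_less[OF assms, of t s] by linarith
qed

lemma rank_image:
  assumes "finite A"
  shows "rank A ` A = {..<card A}"
proof (rule card_subset_eq)
  show "rank A ` A \<subseteq> {..<card A}"
    unfolding rank_def using assms by (auto intro!: psubset_card_mono)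
  show "card (rank A ` A) = card {..<card A}"
    using card_image[OF rank_inj[OF assms]] by simp
qed simp

lemma rank_eq_0_iff:
  assumes "finite A" "t \<in> A"
  shows "rank A t = 0 \<longleftrightarrow> t = Min A"
proof
  assume "rank A t = 0"
  then have "{t' \<in> A. t' < t} = {}" using assms by (simp add: rank_def)
  then show "t = Min A" using assms by (metis (mono_tags, lifting) Min_in Min_le empty_iff mem_Collect_eq not_less_iff_gr_or_eq order_less_le)
next
  assume "t = Min A"
  then have "\<not> t' < t" if "t' \<in> A" for t' using Min_le[OF assms(1) that] by simp
  then have "{t' \<in> A. t' < t} = {}" by blast
  then show "rank A t = 0" by (simp only: rank_def card.empty)
qed

lemma lab_eq_rank: "lab P (r, t) = (r, rank (edgepts P r) t)"
  by (simp add: lab_def rank_def)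

text \<open>The strict bounds exclude outer ends and the vertex, so each point has a two-sided
  neighbourhood in its edge, as the local orientation notions require.\<close>

locale finite_invariant =
  fixes m n :: nat and P :: "(nat \<times> real) set"
  assumes finite_P: "finite P" and P_bounds: "\<And>r t. (r, t) \<in> P \<Longrightarrow> r < n \<and> 0 < t \<and> t < 1"
    and image_P: "fmap m n ` P = P"
begin

lemma mem_edgepts: "t \<in> edgepts P r \<longleftrightarrow> (r, t) \<in> P"
  using P_bounds by (auto simp: edgepts_def)

lemma finite_edgepts: "finite (edgepts P r)"
proof (rule finite_subset)
  show "edgepts P r \<subseteq> snd ` P" by (force simp: mem_edgepts)
qed (use finite_P in simp)

lemma lab_bij: "bij_betw (lab P) P (Lab n (Nc (dataof m n P)))"
  unfolding bij_betw_def
proof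
  show "inj_on (lab P) P"
  proof (rule inj_onI)
    fix p q assume "p \<in> P" "q \<in> P" "lab P p = lab P q"
    then show "p = q"
      using inj_onD[OF rank_inj[OF finite_edgepts]] by (cases p, cases q) (auto simp: lab_eq_rank mem_edgepts)
  qed
  show "lab P ` P = Lab n (Nc (dataof m n P))"
  proof (intro equalityI subsetI)
    fix x assume "x \<in> lab P ` P"
    then obtain r t where "(r, t) \<in> P" "x = (r, rank (edgepts P r) t)"
      by (auto simp: lab_eq_rank)
    moreover then have "rank (edgepts P r) t \<in> {..<card (edgepts P r)}"
      using rank_image[OF finite_edgepts, of r] mem_edgepts by blast
    ultimately show "x \<in> Lab n (Nc (dataof m n P))"
      using P_bounds by (auto simp: Lab_def dataof_def Let_def)
  next
    fix x assume "x \<in> Lab n (Nc (dataof m n P))"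
    then obtain r s where x: "x = (r, s)" "s < card (edgepts P r)"
      by (auto simp: Lab_def dataof_def Let_def split: if_splits)
    then have "s \<in> rank (edgepts P r) ` edgepts P r"
      unfolding rank_image[OF finite_edgepts] by simp
    then show "x \<in> lab P ` P" using x(1) mem_edgepts by (force simp: lab_eq_rank)
  qed
qed

lemma ptof_lab:
  assumes "q \<in> P"
  shows "ptof P (lab P q) = q"
  unfolding ptof_def
proof (rule the_equality)
  show "q' = q" if "q' \<in> P \<and> lab P q' = lab P q" for q'
    using lab_bij assms that unfolding bij_betw_def inj_on_def by blast
qed (use assms in simp)

lemma lab_in_Lab: "q \<in> P \<Longrightarrow> lab P q \<in> Lab n (Nc (dataof m n P))"
  using lab_bij bij_betwE by blast

lemma perm_lab: "q \<in> P \<Longrightarrow> perm (dataof m n P) (lab P q) = lab P (fmap m n q)"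
  using lab_in_Lab[of q] ptof_lab[of q] by (simp add: dataof_def Let_def)

lemma perm_bij: "bij_betw (perm (dataof m n P)) (Lab n (Nc (dataof m n P))) (Lab n (Nc (dataof m n P)))"
proof (rule bij_betw_imageI)
  let ?L = "Lab n (Nc (dataof m n P))"
  have L: "lab P ` P = ?L" using lab_bij by (simp add: bij_betw_def)
  show im: "perm (dataof m n P) ` ?L = ?L"
  proof -
    have "perm (dataof m n P) ` lab P ` P = lab P ` fmap m n ` P"
      unfolding image_image using perm_lab by (intro image_cong) auto
    then show ?thesis unfolding image_P L .
  qed
  have "finite ?L" using finite_P L by (metis finite_imageI)
  then show "inj_on (perm (dataof m n P)) ?L" using im by (simp add: eq_card_imp_inj_on)
qed

end

section \<open>Local behaviour of the truncated map on e_0\<close>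

lemma loc_rev_not_noninj: "loc_rev g t \<Longrightarrow> \<not> loc_noninj g t"
proof
  assume "loc_rev g t" "loc_noninj g t"
  from \<open>loc_rev g t\<close> obtain \<epsilon> j where e: "0 < \<epsilon>" "\<And>t1 t2. t - \<epsilon> < t1 \<Longrightarrow> t1 < t2 \<Longrightarrow> t2 < t + \<epsilon> \<Longrightarrow>
      snd (g (0, t2)) < snd (g (0, t1))"
    unfolding loc_rev_def by blast
  from \<open>loc_noninj g t\<close> e(1) obtain t1 t2 where t: "t1 \<noteq> t2" "\<bar>t1 - t\<bar> < \<epsilon>" "\<bar>t2 - t\<bar> < \<epsilon>"
    "g (0, t1) = g (0, t2)"
    unfolding loc_noninj_def by blast
  then consider "t1 < t2" | "t2 < t1" by linarith
  then show False
  proof cases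
    case 1
    then show False using e(2)[of t1 t2] t by (auto simp: abs_less_iff)
  next
    case 2
    then show False using e(2)[of t2 t1] t by (auto simp: abs_less_iff)
  qed
qed

lemma loc_pres_not_noninj: "loc_pres g t \<Longrightarrow> \<not> loc_noninj g t"
proof
  assume "loc_pres g t" "loc_noninj g t"
  from \<open>loc_pres g t\<close> obtain \<epsilon> j where e: "0 < \<epsilon>" "\<And>t1 t2. t - \<epsilon> < t1 \<Longrightarrow> t1 < t2 \<Longrightarrow> t2 < t + \<epsilon> \<Longrightarrow>
      snd (g (0, t1)) < snd (g (0, t2))"
    unfolding loc_pres_def by blast
  from \<open>loc_noninj g t\<close> e(1) obtain t1 t2 where t: "t1 \<noteq> t2" "\<bar>t1 - t\<bar> < \<epsilon>" "\<bar>t2 - t\<bar> < \<epsilon>"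
    "g (0, t1) = g (0, t2)"
    unfolding loc_noninj_def by blast
  then consider "t1 < t2" | "t2 < t1" by linarith
  then show False
  proof cases
    case 1
    then show False using e(2)[of t1 t2] t by (auto simp: abs_less_iff)
  next
    case 2
    then show False using e(2)[of t2 t1] t by (auto simp: abs_less_iff)
  qed
qed

lemma loc_rev_not_pres: "loc_rev g t \<Longrightarrow> \<not> loc_pres g t"
proof
  assume "loc_rev g t" "loc_pres g t"
  from \<open>loc_rev g t\<close> obtain \<epsilon> where e: "0 < \<epsilon>" "\<And>t1 t2. t - \<epsilon> < t1 \<Longrightarrow> t1 < t2 \<Longrightarrow> t2 < t + \<epsilon> \<Longrightarrow>
      snd (g (0, t2)) < snd (g (0, t1))"
    unfolding loc_rev_def by blast
  from \<open>loc_pres g t\<close> obtain \<eta> where h: "0 < \<eta>" "\<And>t1 t2. t - \<eta> < t1 \<Longrightarrow> t1 < t2 \<Longrightarrow> t2 < t + \<eta> \<Longrightarrow>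
      snd (g (0, t1)) < snd (g (0, t2))"
    unfolding loc_pres_def by blast
  define u where "u = t + min \<epsilon> \<eta> / 2"
  have u: "t < u" "u < t + \<epsilon>" "u < t + \<eta>" using e(1) h(1) by (auto simp: u_def min_def)
  show False using e(2)[of t u] h(2)[of t u] u e(1) h(1) by simp
qed

text \<open>Near t the map is affine along the landing edge and then cut off from below at
  \<open>c\<close>. Above \<open>c\<close> it keeps the orientation of the piece; at or below
  \<open>c\<close> it is constant on at least one side of t.\<close>

lemma trunc_local:
  fixes m n P t
  defines "c \<equiv> tmin P ((piece m t + 1) div 2)"
  assumes t: "0 \<le> t" "t < 1" "0 < zig m t" "zig m t < 1" and c: "c < 1"
  shows "loc_rev (trunc m n P) t \<longleftrightarrow> odd (piece m t) \<and> c < zig m t"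
    and "loc_pres (trunc m n P) t \<longleftrightarrow> even (piece m t) \<and> c < zig m t"
    and "loc_noninj (trunc m n P) t \<longleftrightarrow> zig m t \<le> c"
proof -
  let ?g = "trunc m n P" and ?e = "(piece m t + 1) div 2"
  define M where "M = real (2 * m + 1)"
  have M: "1 \<le> M" by (simp add: M_def)
  define \<sigma> where "\<sigma> = (if even (piece m t) then M else - M)"
  obtain \<epsilon> where \<epsilon>: "0 < \<epsilon>" "0 < t - \<epsilon>" "t + \<epsilon> < 1"
    "\<And>t'. \<bar>t' - t\<bar> < \<epsilon> \<Longrightarrow> piece m t' = piece m t \<and> 0 < zig m t' \<and> zig m t' < 1"
    using piece_locally_constant[OF t] by blast
  have zig: "zig m t' = zig m t + \<sigma> * (t' - t)" if "\<bar>t' - t\<bar> < \<epsilon>" for t'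
  proof -
    have "0 \<le> t'" using that \<epsilon>(2) by linarith
    then show ?thesis
      using piece_zig[of t' m] piece_zig[OF t(1), of m] \<epsilon>(4)[OF that]
      by (auto simp: \<sigma>_def M_def algebra_simps split: if_splits)
  qed
  have g: "?g (0, t') = (?e, max (zig m t') c)" if "\<bar>t' - t\<bar> < \<epsilon>" for t'
  proof -
    have "t' < 1" using that \<epsilon>(3) by linarith
    then have "fmap m n (0, t') = (?e, zig m t')"
      using \<epsilon>(4)[OF that] by (simp add: fmap_zero mkpt_def)
    then show ?thesis using \<epsilon>(4)[OF that] by (simp add: trunc_def retr_def vtx_def c_def)
  qed
  have above: "\<exists>\<eta>. 0 < \<eta> \<and> \<eta> \<le> \<epsilon> \<and> (\<forall>t'. \<bar>t' - t\<bar> < \<eta> \<longrightarrow> ?g (0, t') = (?e, zig m t + \<sigma> * (t' - t))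
      \<and> zig m t' = zig m t + \<sigma> * (t' - t) \<and> zig m t' < 1)"
    if "c < zig m t"
  proof (intro exI conjI allI impI)
    let ?\<eta> = "min \<epsilon> ((zig m t - c) / M)"
    show "0 < ?\<eta>" using \<epsilon>(1) that M by simp
    show "?\<eta> \<le> \<epsilon>" by simp
    fix t' assume t': "\<bar>t' - t\<bar> < ?\<eta>"
    then have 1: "\<bar>t' - t\<bar> < \<epsilon>" by simp
    have "\<bar>t' - t\<bar> < (zig m t - c) / M" using t' by simp
    then have "M * \<bar>t' - t\<bar> < zig m t - c" using M by (simp add: field_simps)
    moreover have "\<bar>\<sigma> * (t' - t)\<bar> = M * \<bar>t' - t\<bar>" using M by (auto simp: \<sigma>_def abs_mult)
    ultimately have "c < zig m t'" using zig[OF 1] by linarith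
    then show "?g (0, t') = (?e, zig m t + \<sigma> * (t' - t))" using g[OF 1] zig[OF 1] by simp
    show "zig m t' = zig m t + \<sigma> * (t' - t)" using zig[OF 1] .
    show "zig m t' < 1" using \<epsilon>(4)[OF 1] by simp
  qed
  have rev: "loc_rev ?g t" if odd: "odd (piece m t)" and gt: "c < zig m t"
  proof -
    obtain \<eta> where \<eta>: "0 < \<eta>" "\<eta> \<le> \<epsilon>" "\<And>t'. \<bar>t' - t\<bar> < \<eta> \<Longrightarrow> ?g (0, t') = (?e, zig m t + \<sigma> * (t' - t))
      \<and> zig m t' = zig m t + \<sigma> * (t' - t) \<and> zig m t' < 1"
      using above[OF gt] by blast
    have "fst (?g (0, t1)) = ?e \<and> fst (?g (0, t2)) = ?e \<and> snd (?g (0, t2)) < snd (?g (0, t1))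
        \<and> snd (?g (0, t1)) < 1" if "t - \<eta> < t1" "t1 < t2" "t2 < t + \<eta>" for t1 t2
    proof -
      have "M * t1 < M * t2" using that(2) M by simp
      moreover have "\<bar>t1 - t\<bar> < \<eta>" "\<bar>t2 - t\<bar> < \<eta>" using that by (auto simp: abs_less_iff)
      ultimately show ?thesis
        using \<eta>(3)[of t1] \<eta>(3)[of t2] odd by (auto simp: \<sigma>_def algebra_simps)
    qed
    moreover have "0 < t - \<eta>" "t + \<eta> < 1" using \<eta>(2) \<epsilon> by auto
    ultimately show ?thesis unfolding loc_rev_def using \<eta>(1) by blast
  qed
  have pres: "loc_pres ?g t" if even: "even (piece m t)" and gt: "c < zig m t"
  proof -
    obtain \<eta> where \<eta>: "0 < \<eta>" "\<eta> \<le> \<epsilon>" "\<And>t'. \<bar>t' - t\<bar> < \<eta> \<Longrightarrow> ?g (0, t') = (?e, zig m t + \<sigma> * (t' - t))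
      \<and> zig m t' = zig m t + \<sigma> * (t' - t) \<and> zig m t' < 1"
      using above[OF gt] by blast
    have "fst (?g (0, t1)) = ?e \<and> fst (?g (0, t2)) = ?e \<and> snd (?g (0, t1)) < snd (?g (0, t2))
        \<and> snd (?g (0, t2)) < 1" if "t - \<eta> < t1" "t1 < t2" "t2 < t + \<eta>" for t1 t2
    proof -
      have "M * t1 < M * t2" using that(2) M by simp
      moreover have "\<bar>t1 - t\<bar> < \<eta>" "\<bar>t2 - t\<bar> < \<eta>" using that by (auto simp: abs_less_iff)
      ultimately show ?thesis
        using \<eta>(3)[of t1] \<eta>(3)[of t2] even by (auto simp: \<sigma>_def algebra_simps)
    qed
    moreover have "0 < t - \<eta>" "t + \<eta> < 1" using \<eta>(2) \<epsilon> by auto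
    ultimately show ?thesis unfolding loc_pres_def using \<eta>(1) by blast
  qed
  have noninj: "loc_noninj ?g t" if "zig m t \<le> c"
    unfolding loc_noninj_def
  proof (intro allI impI)
    fix \<eta> :: real assume "0 < \<eta>"
    define \<mu> where "\<mu> = min \<epsilon> \<eta> / 2"
    have \<mu>: "0 < \<mu>" "\<mu> < \<epsilon>" "\<mu> < \<eta>" using \<open>0 < \<eta>\<close> \<epsilon>(1) by (auto simp: \<mu>_def min_def)
    \<comment> \<open>The direction in which \<open>zig\<close> decreases, so that the values stay
      at or below \<open>c\<close> even when \<open>zig m t\<close> equals \<open>c\<close>.\<close>
    define \<nu> where "\<nu> = (if even (piece m t) then - \<mu> else \<mu>)"
    have \<nu>: "\<bar>\<nu>\<bar> = \<mu>" using \<mu>(1) by (auto simp: \<nu>_def)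
    have flat: "?g (0, t + x * \<nu>) = (?e, c)" if x: "0 \<le> x" "x \<le> 1" for x
    proof -
      have "\<bar>x * \<nu>\<bar> \<le> 1 * \<mu>" unfolding abs_mult \<nu> using x \<mu>(1) by (intro mult_right_mono) auto
      then have 1: "\<bar>(t + x * \<nu>) - t\<bar> < \<epsilon>" using \<mu>(2) by simp
      have "\<sigma> * (x * \<nu>) = - (M * (x * \<mu>))" by (simp add: \<sigma>_def \<nu>_def)
      moreover have "0 \<le> M * (x * \<mu>)" using x M \<mu> by simp
      ultimately have "zig m (t + x * \<nu>) \<le> c" using zig[OF 1] that \<open>zig m t \<le> c\<close> by simp
      then show ?thesis using g[OF 1] by simp
    qed
    show "\<exists>t1 t2. t1 \<noteq> t2 \<and> \<bar>t1 - t\<bar> < \<eta> \<and> \<bar>t2 - t\<bar> < \<eta>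
      \<and> 0 \<le> t1 \<and> t1 < 1 \<and> 0 \<le> t2 \<and> t2 < 1 \<and> ?g (0, t1) = ?g (0, t2)"
    proof (intro exI conjI)
      show "?g (0, t) = ?g (0, t + \<nu>)" using flat[of 0] flat[of 1] by simp
    qed (use \<nu> \<mu> \<epsilon> t \<open>0 < \<eta>\<close> in \<open>auto simp: abs_real_def split: if_splits\<close>)
  qed
  \<comment> \<open>The three implications cover all cases and the three local properties exclude
    one another, which gives the converses.\<close>
  show "loc_rev ?g t \<longleftrightarrow> odd (piece m t) \<and> c < zig m t"
    "loc_pres ?g t \<longleftrightarrow> even (piece m t) \<and> c < zig m t" "loc_noninj ?g t \<longleftrightarrow> zig m t \<le> c"
    using rev pres noninj loc_rev_not_noninj loc_pres_not_noninj loc_rev_not_pres not_le by blast+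
qed

section \<open>The star orbits\<close>

definition edge_set :: "nat \<Rightarrow> nat \<Rightarrow> real set \<Rightarrow> nat \<Rightarrow> real set" where
  "edge_set m n X r = (if r \<in> Orb m n (m - 1) 0 then X else tail m X)"

definition spread :: "nat \<Rightarrow> nat \<Rightarrow> real set \<Rightarrow> (nat \<times> real) set" where
  "spread m n X = {(r, t). r < n \<and> t \<in> edge_set m n X r}"

lemma fmap_vtx: "fmap m n vtx = vtx"
  by (simp add: fmap_def vtx_def)

locale spread_orbit = star_map m n + admissible_orbit m X for m n X
begin

lemma fmap_X:
  assumes "t \<in> X"
  shows "fmap m n (0, t) = (if 2 * m \<le> piece m t + 1 then m else m - 1, zig m t)"
proof -
  have "(piece m t + 1) div 2 = (if 2 * m \<le> piece m t + 1 then m else m - 1)"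
    using piece_cases[OF assms] by auto
  then show ?thesis
    using X_bounds[OF assms] X_bounds[OF zig_in_X[OF assms]] by (simp add: fmap_zero mkpt_def)
qed

lemma edge_set_subset: "edge_set m n X r \<subseteq> X"
  using tail_subset by (simp add: edge_set_def)

lemma edge_set_step:
  assumes "0 < r" "r < n" "t \<in> edge_set m n X r"
  shows "t \<in> edge_set m n X ((r + m) mod n)"
proof (cases "r = n - 1")
  case True
  then show ?thesis using assms(3) edge_set_subset head_in_Z last_step by (auto simp: edge_set_def)
next
  case False
  then show ?thesis using assms Z_step[of r] by (simp add: edge_set_def)
qed

lemma spread_closed:
  assumes "q \<in> spread m n X"
  shows "fmap m n q \<in> spread m n X"
proof -
  obtain r t where q: "q = (r, t)" "r < n" "t \<in> edge_set m n X r"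
    using assms by (auto simp: spread_def)
  have t: "t \<in> X" using q(3) edge_set_subset by blast
  show ?thesis
  proof (cases "r = 0")
    case True
    have "zig m t \<in> tail m X" if "2 * m \<le> piece m t + 1"
      using that t by (auto simp: tail_def)
    then show ?thesis
      using fmap_X[OF t] zig_in_X[OF t] head_in_Z m_notin_Z m_less q(1) True
      by (auto simp: spread_def edge_set_def)
  next
    case False
    then show ?thesis
      using q edge_set_step[of r t] X_bounds(2)[OF t] by (simp add: fmap_nonzero spread_def)
  qed
qed

text \<open>Serves twice: to see that \<open>spread m n X\<close> is a single orbit, and that a
  given star orbit contains the spread of its trace on e_0.\<close>

lemma spread_least:
  assumes base: "\<And>t. t \<in> X \<Longrightarrow> (0, t) \<in> Q" and closed: "\<And>q. q \<in> Q \<Longrightarrow> fmap m n q \<in> Q"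
  shows "spread m n X \<subseteq> Q"
proof -
  have rotate: "((r + m) mod n, t) \<in> Q" if "(r, t) \<in> Q" "0 < r" "t \<in> X" for r t
    using closed[OF that(1)] that X_bounds(2) by (simp add: fmap_nonzero)
  have tail: "(r, t) \<in> Q" if t: "t \<in> tail m X" and r: "r \<notin> Z" "r < n" for r t
    using r
  proof (induction rule: notin_Z_forward_induct)
    case head
    obtain u where "u \<in> X" "2 * m \<le> piece m u + 1" "t = zig m u"
      using t unfolding tail_def by blast
    then show ?case using closed[OF base, of u] fmap_X[of u] by simp
  next
    case (step r)
    then show ?case using rotate t tail_subset by blast
  qed
  have all: "(r, t) \<in> Q" if t: "t \<in> X" and r: "r \<in> Z" "r < n" for r t
    using r
  proof (induction rule: Z_forward_induct)
    case head
    \<comment> \<open>A point of X comes to e_{m-1} straight from e_0 if its preimage lies in the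
      lowest of the three pieces, and otherwise only after the other string, by way of e_{n-1}.
      Hence \<open>tail\<close> had to be settled before.\<close>
    obtain u where u: "u \<in> X" "t = zig m u"
      using t zig_image by blast
    show ?case
    proof (cases "2 * m \<le> piece m u + 1")
      case True
      then have "t \<in> tail m X" using u unfolding tail_def by blast
      then have "(n - 1, t) \<in> Q" using tail last_notin_Z n_ge_2 by simp
      then show ?thesis using rotate[of "n - 1" t] last_step n_ge_2 t by simp
    next
      case False
      then show ?thesis using closed[OF base, of u] fmap_X[of u] u by simp
    qed
  next
    case (step r)
    then show ?case using rotate t by blast
  qed
  show ?thesis using all tail by (auto simp: spread_def edge_set_def split: if_splits)
qed

lemma spread_rotates:
  assumes "\<And>q. q \<in> Q \<Longrightarrow> fmap m n q \<in> Q" "r < n" "(r, t) \<in> Q" "t < 1"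
  shows "(0, t) \<in> Q"
  using assms(2,3)
proof (induction rule: edge_induct)
  case (step r)
  then show ?case using assms(1)[of "(r, t)"] assms(4) by (simp add: fmap_nonzero)
qed

lemma spread_periodic: "periodic_orbit m n (spread m n X)"
  and spread_image: "fmap m n ` spread m n X = spread m n X"
proof -
  let ?f = "fmap m n"
  obtain t p where tp: "0 < p" "(zig m ^^ p) t = t" "X = range (\<lambda>i. (zig m ^^ i) t)"
    using adm unfolding admissible_def by blast
  have t: "t \<in> X" unfolding tp(3) by (rule range_eqI[of _ _ 0]) simp
  \<comment> \<open>Exponents start at 1, so that membership of (0, t) yields a positive
    period.\<close>
  let ?Q = "range (\<lambda>i. (?f ^^ Suc i) (0, t))"
  have closed: "?f q \<in> ?Q" if q: "q \<in> ?Q" for q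
  proof -
    from q obtain i where "q = (?f ^^ Suc i) (0, t)" by (rule rangeE)
    then have "?f q = (?f ^^ Suc (Suc i)) (0, t)" by simp
    then show ?thesis by (rule range_eqI)
  qed
  have zig_iter: "(0, (zig m ^^ Suc i) t) \<in> ?Q" for i
  proof (induction i)
    case 0
    have "?f (0, t) \<in> ?Q" by (rule range_eqI[of _ _ 0]) simp
    then have "((if 2 * m \<le> piece m t + 1 then m else m - 1), zig m t) \<in> ?Q"
      unfolding fmap_X[OF t] .
    moreover have "(if 2 * m \<le> piece m t + 1 then m else m - 1) < n" using m_less by auto
    ultimately have "(0, zig m t) \<in> ?Q"
      using spread_rotates[OF closed] X_bounds(2)[OF zig_in_X[OF t]] by blast
    then show ?case by simp
  next
    case (Suc i)
    let ?u = "(zig m ^^ Suc i) t"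
    have u: "?u \<in> X" using zig_iter_in_X[OF t] .
    have "?f (0, ?u) \<in> ?Q" using closed[OF Suc] .
    then have "((if 2 * m \<le> piece m ?u + 1 then m else m - 1), zig m ?u) \<in> ?Q"
      unfolding fmap_X[OF u] .
    moreover have "(if 2 * m \<le> piece m ?u + 1 then m else m - 1) < n" using m_less by auto
    ultimately have "(0, zig m ?u) \<in> ?Q"
      using spread_rotates[OF closed] X_bounds(2)[OF zig_in_X[OF u]] by blast
    then show ?case by simp
  qed
  have base: "(0, u) \<in> ?Q" if u: "u \<in> X" for u
  proof -
    from u obtain i where i: "u = (zig m ^^ i) t" unfolding tp(3) by (rule rangeE)
    have "u = (zig m ^^ (i + p)) t" by (simp add: i funpow_add tp(2))
    then show ?thesis using zig_iter[of "i + p - 1"] tp(1) by simp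
  qed
  have sub: "spread m n X \<subseteq> ?Q" by (rule spread_least[OF base closed])
  have t0: "(0, t) \<in> spread m n X"
    using t zero_in_Z n_ge_2 by (simp add: spread_def edge_set_def)
  have iter: "(?f ^^ i) (0, t) \<in> spread m n X" for i
    using t0 spread_closed by (induction i) auto
  have eq: "spread m n X = range (\<lambda>i. (?f ^^ i) (0, t))"
  proof
    show "spread m n X \<subseteq> range (\<lambda>i. (?f ^^ i) (0, t))" using sub by (rule order_trans) blast
  qed (use iter in blast)
  from base[OF t] obtain i where i: "(0, t) = (?f ^^ Suc i) (0, t)" by (rule rangeE)
  have "(0, t) \<in> star n" using X_bounds[OF t] n_ge_2 by (simp add: star_def)
  then show "periodic_orbit m n (spread m n X)"
    unfolding periodic_orbit_def using eq i[symmetric]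
    by (intro exI[of _ "(0, t)"] exI[of _ "Suc i"] conjI) (rule zero_less_Suc | assumption)+
  show "?f ` spread m n X = spread m n X"
    using periodic_range(2)[OF _ i[symmetric] eq] by simp
qed

sublocale finite_invariant m n "spread m n X"
proof
  show "finite (spread m n X)"
  proof (rule finite_subset)
    show "spread m n X \<subseteq> {..<n} \<times> X" using edge_set_subset by (auto simp: spread_def)
  qed (use finite_X in simp)
  show "r < n \<and> 0 < t \<and> t < 1" if "(r, t) \<in> spread m n X" for r t
    using that edge_set_subset X_bounds by (auto simp: spread_def)
qed (rule spread_image)

lemma edgepts_spread: "r < n \<Longrightarrow> edgepts (spread m n X) r = edge_set m n X r"
  using edge_set_subset X_bounds by (auto simp: edgepts_def spread_def)

text \<open>The minimum of X survives in the tail, so all edges share it. Together with isometric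
  rotation this is the nearest-point condition on a star orbit.\<close>

lemma tmin_spread: "r < n \<Longrightarrow> tmin (spread m n X) r = Min X"
  using Min_tail by (simp add: tmin_def edgepts_spread edge_set_def)

lemma star_orbit_spread: "star_orbit m n (spread m n X)"
  unfolding star_orbit_def
proof (intro conjI allI impI)
  show "periodic_orbit m n (spread m n X)" by (rule spread_periodic)
  show "spread m n X \<noteq> {vtx}" using P_bounds[of 0 1] by (auto simp: vtx_def)
  show "edgepts (spread m n X) r \<noteq> {}" if "r < n" for r
    using X_nonempty Min_in_tail by (auto simp: edgepts_spread[OF that] edge_set_def)
  obtain t where t: "t \<in> X" "piece m t + 2 = 2 * m" using ex_low by blast
  have "t \<in> edgepts (spread m n X) 0"
    using t(1) zero_in_Z n_ge_2 by (simp add: edgepts_spread edge_set_def)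
  moreover have "fmap m n (0, t) \<notin> {(m, t) |t. t < 1} \<union> {vtx}"
    using fmap_X[OF t(1)] t X_bounds(2)[OF zig_in_X[OF t(1)]] pos_m by (auto simp: vtx_def)
  ultimately show "\<not> fmap m n ` {(0, t) |t. t \<in> edgepts (spread m n X) 0} \<subseteq> {(m, t) |t. t < 1} \<union> {vtx}"
    by blast
  fix r assume r: "0 < r \<and> r < n"
  have "Min X \<in> X" using finite_X X_nonempty by simp
  then show "fmap m n (r, tmin (spread m n X) r) = ((r + m) mod n, tmin (spread m n X) ((r + m) mod n))"
    using r tmin_spread X_bounds(2) by (simp add: fmap_nonzero)
qed

end

section \<open>Every orbit in P(m/n, m - 1, B) is the spread of its trace on e_0\<close>

context star_map
begin

lemma fmap_star: "q \<in> star n \<Longrightarrow> fmap m n q \<in> star n"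
proof -
  assume "q \<in> star n"
  then consider "q = vtx" | t where "q = (0, t)" "t < 1" "0 \<le> t"
    | r t where "q = (r, t)" "r \<noteq> 0" "0 \<le> t" "t < 1"
    unfolding star_def by force
  then show ?thesis
  proof cases
    case 1
    then show ?thesis by (simp add: fmap_vtx star_def)
  next
    case 2
    have "(piece m t + 1) div 2 < n" using piece_le[OF 2(2), of m] m_less by linarith
    then show ?thesis
      using 2 zig_bounds[of m t] by (auto simp: fmap_zero mkpt_def star_def)
  next
    case 3
    then show ?thesis using n_ge_2 by (simp add: fmap_nonzero star_def)
  qed
qed

text \<open>The vertex and (0, 0) are fixed, and a periodic orbit containing a fixed point is a
  singleton, which is either {v} or misses e_1. The other outer ends rotate to (0, 0).\<close>

lemma star_orbit_invariant:
  assumes "star_orbit m n P"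
  shows "finite_invariant m n P" "\<And>p q. p \<in> P \<Longrightarrow> q \<in> P \<Longrightarrow> \<exists>i. (fmap m n ^^ i) p = q"
proof -
  obtain x p where x: "x \<in> star n" "0 < p" "(fmap m n ^^ p) x = x" "P = range (\<lambda>i. (fmap m n ^^ i) x)"
    using assms unfolding star_orbit_def periodic_orbit_def by blast
  note per = periodic_range[OF x(2-4)]
  show reach: "\<exists>i. (fmap m n ^^ i) p = q" if "p \<in> P" "q \<in> P" for p q
    using per(4)[OF that] .
  have "(fmap m n ^^ i) x \<in> star n" for i
    using x(1) fmap_star by (induction i) auto
  then have sub: "P \<subseteq> star n" using x(4) by blast
  have fixed: "P = {q}" if q: "q \<in> P" "fmap m n q = q" for q
  proof -
    have iter: "(fmap m n ^^ i) q = q" for i using q(2) by (induction i) simp_all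
    have "y = q" if "y \<in> P" for y using reach[OF q(1) that] unfolding iter by simp
    then show ?thesis using q(1) by blast
  qed
  have novtx: "vtx \<notin> P" using fixed[OF _ fmap_vtx] assms unfolding star_orbit_def by blast
  have closed: "fmap m n q \<in> P" if "q \<in> P" for q using per(2) that by blast
  have "(0, 0) \<notin> P"
  proof
    assume a: "(0, 0) \<in> P"
    have "piece m 0 = 0" "zig m 0 = 0" by (simp_all add: piece_def zig_def)
    then have "fmap m n (0, 0) = (0, 0)" by (simp add: fmap_zero mkpt_def)
    then have "P = {(0, 0)}" using fixed[OF a] by simp
    moreover have "edgepts P 1 \<noteq> {}" using assms n_ge_2 unfolding star_orbit_def by simp
    ultimately show False by (simp add: edgepts_def)
  qed
  moreover have "(0, 0) \<in> P" if "r < n" "(r, 0) \<in> P" for r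
    using that
  proof (induction rule: edge_induct)
    case (step r)
    then show ?case using closed[of "(r, 0)"] by (simp add: fmap_nonzero)
  qed
  ultimately have nonzero: "(r, 0) \<notin> P" if "r < n" for r using that by blast
  show "finite_invariant m n P"
  proof
    fix r t assume rt: "(r, t) \<in> P"
    then have "r < n" "0 \<le> t" "t < 1" using sub novtx by (auto simp: star_def)
    moreover have "t \<noteq> 0" using nonzero[OF \<open>r < n\<close>] rt by blast
    ultimately show "r < n \<and> 0 < t \<and> t < 1" by simp
  qed (use per in auto)
qed

lemma star_orbit_is_spread:
  assumes so: "star_orbit m n P" and low: "fst (perm (dataof m n P) (0, 0)) = m - 1"
    and B: "0 \<in> Bset (dataof m n P)"
  shows "\<exists>X. admissible m X \<and> P = spread m n X"
proof -
  interpret finite_invariant m n P using star_orbit_invariant(1)[OF so] .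
  let ?f = "fmap m n"
  note reach = star_orbit_invariant(2)[OF so]
  have closed: "?f q \<in> P" if "q \<in> P" for q using image_P that by blast
  define X where "X = edgepts P 0"
  have X: "t \<in> X \<longleftrightarrow> (0, t) \<in> P" for t by (simp add: X_def mem_edgepts)
  have fX: "finite X" unfolding X_def by (rule finite_edgepts)
  have neX: "edgepts P r \<noteq> {}" if "r < n" for r using so that unfolding star_orbit_def by blast
  have X_bounds: "0 < t" "t < 1" if "t \<in> X" for t using P_bounds that X by auto
  have rot: "(0, t) \<in> P" if "r < n" "(r, t) \<in> P" for r t
    using that
  proof (induction rule: edge_induct)
    case (step r)
    then show ?case using closed[of "(r, t)"] P_bounds by (simp add: fmap_nonzero)
  qed
  have f0: "?f (0, t) = ((piece m t + 1) div 2, zig m t)" "zig m t \<in> X" if "t \<in> X" for t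
  proof -
    have in_P: "?f (0, t) \<in> P" using closed that X by blast
    have eq: "?f (0, t) = mkpt ((piece m t + 1) div 2) (zig m t)" using X_bounds[OF that] by (simp add: fmap_zero)
    have "zig m t \<noteq> 1"
    proof
      assume "zig m t = 1"
      then have "(0, 1) \<in> P" using in_P eq by (simp add: mkpt_def vtx_def)
      then show False using P_bounds by blast
    qed
    then show "?f (0, t) = ((piece m t + 1) div 2, zig m t)" using eq by (simp add: mkpt_def)
    then show "zig m t \<in> X" using in_P rot P_bounds X by metis
  qed
  have n0: "0 < n" using n_ge_2 by simp
  have neX0: "X \<noteq> {}" unfolding X_def by (rule neX[OF n0])
  then have MinX: "Min X \<in> X" using fX by simp

  \<comment> \<open>Nearest points rotate to nearest points without changing coordinate, so every
    edge inherits the minimum of e_0.\<close>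
  have tmins: "tmin P r = Min X" if "r < n" for r
    using that
  proof (induction rule: edge_induct)
    case zero
    then show ?case by (simp add: tmin_def X_def)
  next
    case (step r)
    have "tmin P r \<in> edgepts P r"
      unfolding tmin_def using finite_edgepts neX step by simp
    then have "tmin P r < 1" using mem_edgepts P_bounds by blast
    moreover have "?f (r, tmin P r) = ((r + m) mod n, tmin P ((r + m) mod n))"
      using so step unfolding star_orbit_def by blast
    ultimately show ?case using step by (simp add: fmap_nonzero)
  qed

  have lab0: "lab P (0, Min X) = (0, 0)"
    using rank_eq_0_iff[OF fX MinX] by (simp add: lab_eq_rank X_def)
  have ptof0: "ptof P (0, 0) = (0, Min X)"
    using ptof_lab[of "(0, Min X)"] lab0 MinX X by simp
  have "perm (dataof m n P) (0, 0) = lab P (?f (0, Min X))"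
    using perm_lab[of "(0, Min X)"] lab0 MinX X by simp
  then have low': "(piece m (Min X) + 1) div 2 = m - 1"
    using low f0(1)[OF MinX] by (simp add: lab_def)
  have "loc_pres (trunc m n P) (Min X)"
    using B ptof0 by (simp add: dataof_def Let_def)
  moreover have "tmin P ((piece m (Min X) + 1) div 2) < 1"
    using low' tmins m_less X_bounds(2)[OF MinX] by simp
  ultimately have "even (piece m (Min X))"
    using trunc_local(2)[of "Min X" m P] X_bounds[OF MinX] X_bounds[OF f0(2)[OF MinX]] by simp
  then have Min_piece: "piece m (Min X) + 2 = 2 * m"
    using low' m_pos by presburger
  have pieces: "2 * m \<le> piece m t + 2" if "t \<in> X" for t
  proof -
    have "Min X \<le> t" using fX that by simp
    then show ?thesis using piece_mono[of "Min X" t m] Min_piece by linarith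
  qed
  have edge: "(piece m t + 1) div 2 = (if 2 * m \<le> piece m t + 1 then m else m - 1)" if "t \<in> X" for t
    using pieces[OF that] piece_le[OF X_bounds(2)[OF that], of m] m_pos by (cases "2 * m \<le> piece m t + 1") (simp, presburger)+

  have snd_f: "snd (?f q) = (if fst q = 0 then zig m (snd q) else snd q)" if "q \<in> P" for q
    using that f0(1) X P_bounds by (cases q) (auto simp: fmap_nonzero)
  \<comment> \<open>Forgetting the edge turns iteration of \<open>fmap\<close> into iteration of the
    zigzag map with pauses on the other edges. The exponent is positive because the first step
    leaves from e_0; this later gives a positive zigzag period.\<close>
  have fiber: "\<exists>k>0. snd ((?f ^^ Suc i) (0, Min X)) = (zig m ^^ k) (Min X)" for i
  proof (induction i)
    case 0
    then show ?case using f0(1)[OF MinX] by (intro exI[of _ 1]) simp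
  next
    case (Suc i)
    then obtain k where k: "0 < k" "snd ((?f ^^ Suc i) (0, Min X)) = (zig m ^^ k) (Min X)" by blast
    have "(?f ^^ j) (0, Min X) \<in> P" for j using MinX X closed by (induction j) auto
    from snd_f[OF this[of "Suc i"]] k show ?case
      by (cases "fst ((?f ^^ Suc i) (0, Min X)) = 0") (auto intro: exI[of _ "Suc k"])
  qed
  have zig_orbit: "(zig m ^^ k) (Min X) \<in> X" for k using MinX f0(2) by (induction k) auto
  have X_eq: "X = range (\<lambda>k. (zig m ^^ k) (Min X))"
  proof (intro equalityI subsetI)
    fix t assume "t \<in> X"
    then obtain i where i: "(?f ^^ i) (0, Min X) = (0, t)" using reach MinX X by blast
    show "t \<in> range (\<lambda>k. (zig m ^^ k) (Min X))"
    proof (cases i)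
      case 0
      then show ?thesis using i by (intro range_eqI[of _ _ 0]) simp
    next
      case (Suc j)
      then show ?thesis using fiber[of j] i by auto
    qed
  qed (use zig_orbit in blast)
  obtain i where "(?f ^^ i) (?f (0, Min X)) = (0, Min X)" using reach closed MinX X by blast
  then have "(?f ^^ Suc i) (0, Min X) = (0, Min X)" by (simp add: funpow_swap1)
  then obtain p where p: "0 < p" "(zig m ^^ p) (Min X) = Min X" using fiber[of i] by auto

  \<comment> \<open>Preimages are followed backwards: e_m is entered only from the last two pieces
    of e_0, and each later edge of its string only by rotation, since e_0 feeds no edges but e_m and
    e_{m-1}.\<close>
  have tail: "t \<in> tail m X" if r: "r \<notin> Z" "r < n" and "(r, t) \<in> P" for r t
    using that
  proof (induction rule: notin_Z_forward_induct)
    case head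
    then obtain q where q: "q \<in> P" "(m, t) = ?f q" using image_P by blast
    obtain r' t' where rt: "q = (r', t')" by (cases q)
    have b: "r' < n" "t' < 1" using P_bounds q(1) rt by auto
    show ?case
    proof (cases "r' = 0")
      case True
      then have t': "t' \<in> X" using q(1) rt X by simp
      then have "m = (piece m t' + 1) div 2" "t = zig m t'"
        using q(2) f0(1) rt True by auto
      then show ?thesis using edge[OF t'] t' m_pos unfolding tail_def by (auto split: if_splits)
    next
      case False
      then have "(0 + m) mod n = (r' + m) mod n" using q(2) rt b m_less by (simp add: fmap_nonzero)
      then show ?thesis using add_m_inj[of 0 r'] False b n0 by simp
    qed
  next
    case (step r)
    obtain q where q: "q \<in> P" "((r + m) mod n, t) = ?f q" using image_P step.prems by blast
    obtain r' t' where rt: "q = (r', t')" by (cases q)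
    have b: "r' < n" "t' < 1" using P_bounds q(1) rt by auto
    show ?case
    proof (cases "r' = 0")
      case True
      then have t': "t' \<in> X" using q(1) rt X by simp
      then have "(r + m) mod n = m \<or> (r + m) mod n = m - 1"
        using q(2) f0(1) rt True edge by auto
      then have "(r + m) mod n = (0 + m) mod n \<or> (r + m) mod n = (n - 1 + m) mod n"
        using last_step m_less by simp
      moreover have "r < n" "r \<noteq> 0" "r \<noteq> n - 1" "n - 1 < n" using step.hyps n0 by auto
      ultimately show ?thesis using add_m_inj[of r 0] add_m_inj[of r "n - 1"] n0 by blast
    next
      case False
      then have "(r + m) mod n = (r' + m) mod n" "t' = t" using q(2) rt b by (simp_all add: fmap_nonzero)
      moreover have "r < n" using step.hyps by simp
      ultimately have "q = (r, t)" using add_m_inj[of r r'] b rt by blast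
      then show ?thesis using step.IH q(1) by blast
    qed
  qed
  have "tmin P (n - 1) \<in> edgepts P (n - 1)"
    unfolding tmin_def using finite_edgepts neX n0 by simp
  then have "(n - 1, Min X) \<in> P" using tmins[of "n - 1"] n0 mem_edgepts by simp
  then have Min_tail: "Min X \<in> tail m X" using tail last_notin_Z n0 by simp
  have adm: "admissible m X"
    unfolding admissible_def
  proof (intro conjI exI)
    show "0 < p" "(zig m ^^ p) (Min X) = Min X" by (fact p)+
    show "X = range (\<lambda>i. (zig m ^^ i) (Min X))" by (fact X_eq)
  qed (use X_bounds pieces Min_piece MinX Min_tail in auto)
  interpret sp: spread_orbit m n X
    by unfold_locales (rule m_pos, rule adm)
  have "P \<subseteq> spread m n X"
  proof
    fix q assume q: "q \<in> P"
    obtain r t where rt: "q = (r, t)" by (cases q)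
    have "r < n" using P_bounds q rt by blast
    then show "q \<in> spread m n X"
      using tail rot q rt X by (auto simp: spread_def edge_set_def)
  qed
  moreover have "spread m n X \<subseteq> P" using X closed by (intro sp.spread_least) auto
  ultimately show ?thesis using adm by blast
qed

end

section \<open>The data of a star orbit\<close>

context spread_orbit
begin

lemma edge_set_zero: "edge_set m n X 0 = X"
  using zero_in_Z by (simp add: edge_set_def)

lemma edge_set_last: "edge_set m n X (n - 1) = tail m X"
  using last_notin_Z by (simp add: edge_set_def)

lemma edge_set_head: "edge_set m n X (m - 1) = X"
  using head_in_Z by (simp add: edge_set_def)

lemma edge_set_m: "edge_set m n X m = tail m X"
  using m_notin_Z by (simp add: edge_set_def)

lemma finite_edge_set: "finite (edge_set m n X r)"
  using edge_set_subset finite_X finite_subset by blast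

abbreviation \<D> :: sdata where "\<D> \<equiv> dataof m n (spread m n X)"

lemma Nc_spread: "Nc \<D> r = (if r < n then card (edge_set m n X r) else 0)"
  by (simp add: dataof_def Let_def edgepts_spread)

lemma lab_spread: "r < n \<Longrightarrow> lab (spread m n X) (r, t) = (r, rank (edge_set m n X r) t)"
  by (simp add: lab_eq_rank edgepts_spread)

lemma mem_spread: "(r, t) \<in> spread m n X \<longleftrightarrow> r < n \<and> t \<in> edge_set m n X r"
  by (simp add: spread_def)

lemma perm_spread:
  assumes "r < n" "t \<in> edge_set m n X r"
  shows "perm \<D> (r, rank (edge_set m n X r) t) = lab (spread m n X) (fmap m n (r, t))"
  using perm_lab[of "(r, t)"] assms by (simp add: lab_spread mem_spread)

lemma perm_zero:
  assumes "t \<in> X"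
  shows "perm \<D> (0, rank X t) =
    (if 2 * m \<le> piece m t + 1 then (m, rank (tail m X) (zig m t)) else (m - 1, rank X (zig m t)))"
  using perm_spread[of 0 t] assms fmap_X[OF assms] m_less n_ge_2
  by (simp add: edge_set_zero lab_spread edge_set_m edge_set_head[simplified])

lemma perm_last:
  assumes "t \<in> tail m X"
  shows "perm \<D> (n - 1, rank (tail m X) t) = (m - 1, rank X t)"
proof -
  have t: "t < 1" using assms tail_subset X_bounds by blast
  have r: "n - 1 < n" "n - 1 \<noteq> 0" "m - 1 < n" using n_ge_2 m_less by auto
  have "perm \<D> (n - 1, rank (tail m X) t) = lab (spread m n X) (fmap m n (n - 1, t))"
    using perm_spread[OF r(1)] assms unfolding edge_set_last by blast
  then show ?thesis
    using fmap_nonzero[OF r(2) t, of m n] lab_spread[OF r(3), of t] unfolding last_step edge_set_head by simp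
qed

text \<open>Consecutive edges inside a string carry the same coordinates, so ranks do not
  change.\<close>

lemma perm_mid:
  assumes "0 < r" "r < n - 1" "s < Nc \<D> r"
  shows "perm \<D> (r, s) = ((r + m) mod n, s)"
proof -
  have r: "r < n" using assms(2) by simp
  then have "s \<in> rank (edge_set m n X r) ` edge_set m n X r"
    using assms(3) unfolding rank_image[OF finite_edge_set] by (simp add: Nc_spread)
  then obtain t where t: "t \<in> edge_set m n X r" "s = rank (edge_set m n X r) t" by blast
  have "t < 1" using t(1) edge_set_subset X_bounds by blast
  moreover have "edge_set m n X ((r + m) mod n) = edge_set m n X r"
    using Z_step[of r] assms r by (simp add: edge_set_def)
  ultimately show ?thesis
    using perm_spread[OF r t(1)] t(2) assms(1) n_ge_2 by (simp add: fmap_nonzero lab_spread)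
qed

lemma perm_outside: "x \<notin> Lab n (Nc \<D>) \<Longrightarrow> perm \<D> x = x"
  by (simp add: dataof_def Let_def)

text \<open>On every landing edge the truncation cuts at \<open>Min X\<close>, and no image of a
  point of X lies below it; so the flat case is that of image \<open>Min X\<close>.\<close>

lemma loc_spread:
  assumes "t \<in> X"
  shows "loc_rev (trunc m n (spread m n X)) t \<longleftrightarrow> odd (piece m t) \<and> zig m t \<noteq> Min X"
    and "loc_pres (trunc m n (spread m n X)) t \<longleftrightarrow> even (piece m t) \<and> zig m t \<noteq> Min X"
    and "loc_noninj (trunc m n (spread m n X)) t \<longleftrightarrow> zig m t = Min X"
proof -
  have "(piece m t + 1) div 2 < n" using piece_cases[OF assms] m_less by linarith
  then have c: "tmin (spread m n X) ((piece m t + 1) div 2) = Min X" by (rule tmin_spread)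
  have MinX: "Min X \<in> X" "Min X \<le> zig m t" using finite_X X_nonempty zig_in_X[OF assms] by auto
  have "tmin (spread m n X) ((piece m t + 1) div 2) < 1" using c X_bounds(2)[OF MinX(1)] by simp
  note loc = trunc_local[OF _ X_bounds(2)[OF assms] X_bounds[OF zig_in_X[OF assms]] this, unfolded c, of n]
  show "loc_rev (trunc m n (spread m n X)) t \<longleftrightarrow> odd (piece m t) \<and> zig m t \<noteq> Min X"
    "loc_pres (trunc m n (spread m n X)) t \<longleftrightarrow> even (piece m t) \<and> zig m t \<noteq> Min X"
    "loc_noninj (trunc m n (spread m n X)) t \<longleftrightarrow> zig m t = Min X"
    using loc X_bounds(1)[OF assms] MinX(2) by auto
qed

lemma labelled_set:
  "{s. s < card X \<and> Q (snd (ptof (spread m n X) (0, s)))} = rank X ` {t \<in> X. Q t}"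
proof -
  have pt: "ptof (spread m n X) (0, rank X t) = (0, t)" if "t \<in> X" for t
    using ptof_lab[of "(0, t)"] that n_ge_2 by (simp add: lab_spread edge_set_zero mem_spread)
  have "{s. s < card X \<and> Q (snd (ptof (spread m n X) (0, s)))}
      = {s \<in> rank X ` X. Q (snd (ptof (spread m n X) (0, s)))}"
    unfolding rank_image[OF finite_X] by auto
  also have "\<dots> = rank X ` {t \<in> X. Q t}" using pt by auto
  finally show ?thesis .
qed

lemma label_sets:
  "Aset \<D> = rank X ` {t \<in> X. odd (piece m t) \<and> zig m t \<noteq> Min X}"
  "Bset \<D> = rank X ` {t \<in> X. even (piece m t) \<and> zig m t \<noteq> Min X}"
  "Cset \<D> = rank X ` {t \<in> X. zig m t = Min X}"
proof -
  have N: "(if 0 < n then card (edgepts (spread m n X) 0) else 0) = card X"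
    using n_ge_2 by (simp add: edgepts_spread edge_set_zero)
  have "Aset \<D> = rank X ` {t \<in> X. loc_rev (trunc m n (spread m n X)) t}"
    "Bset \<D> = rank X ` {t \<in> X. loc_pres (trunc m n (spread m n X)) t}"
    "Cset \<D> = rank X ` {t \<in> X. loc_noninj (trunc m n (spread m n X)) t}"
    unfolding dataof_def Let_def N by (simp_all only: sdata.select_convs labelled_set)
  then show "Aset \<D> = rank X ` {t \<in> X. odd (piece m t) \<and> zig m t \<noteq> Min X}"
    "Bset \<D> = rank X ` {t \<in> X. even (piece m t) \<and> zig m t \<noteq> Min X}"
    "Cset \<D> = rank X ` {t \<in> X. zig m t = Min X}"
    using loc_spread by (auto cong: conj_cong)
qed

lemma spread_in_Pset: "\<D> \<in> Pset m n (m - 1) LB"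
proof -
  have MinX: "Min X \<in> X" using finite_X X_nonempty by simp
  have r0: "rank X (Min X) = 0" using rank_eq_0_iff[OF finite_X MinX] by simp
  have "fst (perm \<D> (0, 0)) = m - 1" using perm_zero[OF MinX] Min_low r0 by simp
  moreover have "even (piece m (Min X))" using Min_low by presburger
  then have "0 \<in> Bset \<D>" unfolding label_sets using MinX r0 zig_Min_greater
    by (intro image_eqI[of _ _ "Min X"]) auto
  ultimately show ?thesis unfolding Pset_def using star_orbit_spread by (auto intro!: exI[of _ "spread m n X"])
qed

lemma perm_transitive:
  assumes "x \<in> Lab n (Nc \<D>)" "y \<in> Lab n (Nc \<D>)"
  shows "\<exists>i. (perm \<D> ^^ i) x = y"
proof -
  have L: "lab (spread m n X) ` spread m n X = Lab n (Nc \<D>)" using lab_bij by (simp add: bij_betw_def)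
  obtain p q where pq: "p \<in> spread m n X" "x = lab (spread m n X) p"
    "q \<in> spread m n X" "y = lab (spread m n X) q"
    using assms L by blast
  obtain i where i: "(fmap m n ^^ i) p = q"
    using star_orbit_invariant(2)[OF star_orbit_spread pq(1,3)] by blast
  have in_P: "(fmap m n ^^ j) p \<in> spread m n X" for j
    using pq(1) spread_closed by (induction j) auto
  have "(perm \<D> ^^ j) x = lab (spread m n X) ((fmap m n ^^ j) p)" for j
    using pq(2) perm_lab[OF in_P] by (induction j) auto
  then show ?thesis using i pq(4) by auto
qed

end

lemma (in star_map) Pset_eq:
  "Pset m n (m - 1) LB = {dataof m n (spread m n X) | X. admissible m X}"
proof (intro equalityI subsetI)
  fix D assume "D \<in> Pset m n (m - 1) LB"
  then obtain P where P: "D = dataof m n P" "star_orbit m n P"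
    "fst (perm (dataof m n P) (0, 0)) = m - 1" "0 \<in> Bset (dataof m n P)"
    unfolding Pset_def by auto
  then show "D \<in> {dataof m n (spread m n X) | X. admissible m X}"
    using star_orbit_is_spread[OF P(2-4)] by blast
next
  fix D assume "D \<in> {dataof m n (spread m n X) | X. admissible m X}"
  then obtain X where X: "D = dataof m n (spread m n X)" "admissible m X" by blast
  interpret spread_orbit m n X by unfold_locales (rule m_pos, rule X(2))
  show "D \<in> Pset m n (m - 1) LB" unfolding X(1) by (rule spread_in_Pset)
qed

lemma phi_sel:
  "Nc (phi m n D) = (\<lambda>r. if r < n then if r \<in> Orb m n (m - 1) 0 then Nc D 0 else Nc D 1 else 0)"
  "perm (phi m n D) x = (if x \<in> Lab n (Nc (phi m n D)) then
     if fst x = 0 then hd_str m (perm D (0, snd x))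
     else if fst x = n - 1 then hd_str m (perm D (1, snd x))
     else ((fst x + m) mod n, snd x)
   else x)"
  "Aset (phi m n D) = Aset D" "Bset (phi m n D) = Bset D" "Cset (phi m n D) = Cset D"
  by (simp_all add: phi_def Let_def)

section \<open>Conjugate orbits have corresponding data\<close>

text \<open>Needed for surjectivity: a given orbit for m is first transported to m = 1, and the
  conjugacy must then be turned round to end at exactly the given orbit.\<close>

lemma conjugates_inv:
  assumes "conjugates m m' X h" and closed: "\<And>x. x \<in> X \<Longrightarrow> zig m x \<in> X"
  obtains g where "conjugates m' m (h ` X) g" "g ` h ` X = X"
proof -
  have mono: "h x < h y" if "x \<in> X" "y \<in> X" "x < y" for x y
    using assms(1) that unfolding conjugates_def by blast
  have inj: "inj_on h X"
  proof (rule inj_onI)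
    fix x y assume "x \<in> X" "y \<in> X" "h x = h y"
    then show "x = y" using mono[of x y] mono[of y x] by fastforce
  qed
  let ?g = "the_inv_into X h"
  have g: "?g (h x) = x" if "x \<in> X" for x using the_inv_into_f_f[OF inj that] .
  have less: "x < y" if "x \<in> X" "y \<in> X" "h x < h y" for x y
    using that mono[of y x] by (cases x y rule: linorder_cases) auto
  have "conjugates m' m (h ` X) ?g"
    unfolding conjugates_def
  proof (intro conjI ballI impI)
    fix x y assume "x \<in> h ` X" "y \<in> h ` X" "x < y"
    then show "?g x < ?g y" using less g by auto
  next
    fix t assume "t \<in> h ` X"
    then obtain u where u: "u \<in> X" "t = h u" by blast
    have 1: "piece m' (h u) + 2 * m = piece m u + 2 * m'" "zig m' (h u) = h (zig m u)"
      using assms(1) u(1) unfolding conjugates_def by auto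
    show "piece m (?g t) + 2 * m' = piece m' t + 2 * m" using 1 g u by simp
    show "zig m (?g t) = ?g (zig m' t)" using 1(2) g u closed by simp
  qed
  moreover have "?g ` h ` X = X" using g by force
  ultimately show ?thesis using that by blast
qed


locale conjugate_orbits = A: spread_orbit 1 2 X + B: spread_orbit m n "h ` X" for X m n h +
  assumes conj: "conjugates 1 m X h"
begin

lemma h_less: "x \<in> X \<Longrightarrow> y \<in> X \<Longrightarrow> x < y \<Longrightarrow> h x < h y"
  and piece_h: "t \<in> X \<Longrightarrow> piece m (h t) + 2 = piece 1 t + 2 * m"
  and zig_h: "t \<in> X \<Longrightarrow> zig m (h t) = h (zig 1 t)"
  using conj unfolding conjugates_def by auto

lemma h_less_iff: "x \<in> X \<Longrightarrow> y \<in> X \<Longrightarrow> h x < h y \<longleftrightarrow> x < y"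
  using h_less[of x y] h_less[of y x] by (cases x y rule: linorder_cases) auto

lemma h_eq_iff: "x \<in> X \<Longrightarrow> y \<in> X \<Longrightarrow> h x = h y \<longleftrightarrow> x = y"
  using h_less[of x y] h_less[of y x] by (cases x y rule: linorder_cases) auto

lemma h_inj: "inj_on h X"
  using h_eq_iff by (simp add: inj_on_def)

lemma rank_h:
  assumes "S \<subseteq> X" "t \<in> X"
  shows "rank (h ` S) (h t) = rank S t"
proof -
  have "{u \<in> h ` S. u < h t} = h ` {u \<in> S. u < t}"
    using assms h_less_iff by auto
  moreover have "inj_on h {u \<in> S. u < t}"
    using assms(1) by (intro inj_on_subset[OF h_inj]) auto
  ultimately show ?thesis by (simp add: rank_def card_image)
qed

lemma high_h: "t \<in> X \<Longrightarrow> 2 * m \<le> piece m (h t) + 1 \<longleftrightarrow> 2 * 1 \<le> piece 1 t + 1"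
  using piece_h[of t] by linarith

lemma tail_h: "tail m (h ` X) = h ` tail 1 X"
proof -
  have "{t \<in> h ` X. 2 * m \<le> piece m t + 1} = h ` {t \<in> X. 2 * 1 \<le> piece 1 t + 1}"
    using high_h by auto
  moreover have "zig m ` h ` {t \<in> X. 2 * 1 \<le> piece 1 t + 1} = h ` zig 1 ` {t \<in> X. 2 * 1 \<le> piece 1 t + 1}"
    unfolding image_image using zig_h by (intro image_cong) auto
  ultimately show ?thesis unfolding tail_def by (simp only:)
qed

lemma Min_h: "Min (h ` X) = h (Min X)"
proof -
  have MinX: "Min X \<in> X" using A.finite_X A.X_nonempty by simp
  show ?thesis
  proof (rule Min_eqI)
    fix y assume "y \<in> h ` X"
    then obtain t where t: "t \<in> X" "y = h t" by blast
    then have "Min X \<le> t" using A.finite_X by simp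
    then show "h (Min X) \<le> y" using h_less[OF MinX t(1)] t(2) by (cases "Min X = t") auto
  qed (use A.finite_X MinX in auto)
qed

lemma card_tail_h: "card (tail m (h ` X)) = card (tail 1 X)"
  unfolding tail_h using inj_on_subset[OF h_inj A.tail_subset] by (rule card_image)

lemma Nc_A: "Nc A.\<D> 0 = card X" "Nc A.\<D> 1 = card (tail 1 X)"
  using A.Nc_spread[of 0] A.Nc_spread[of 1] A.edge_set_zero A.edge_set_last by simp_all

lemma Nc_B: "Nc B.\<D> r = (if r < n then if r \<in> Orb m n (m - 1) 0 then Nc A.\<D> 0 else Nc A.\<D> 1 else 0)"
  unfolding B.Nc_spread edge_set_def Nc_A using card_tail_h card_image[OF h_inj] by simp

lemma perm_zero_h:
  assumes "s < card X"
  shows "perm B.\<D> (0, s) = hd_str m (perm A.\<D> (0, s))"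
proof -
  have "s \<in> rank X ` X" using assms unfolding rank_image[OF A.finite_X] by simp
  then obtain t where t: "t \<in> X" "s = rank X t" by blast
  have ht: "h t \<in> h ` X" "rank (h ` X) (h t) = s" using t rank_h[of X t] by auto
  have z: "zig 1 t \<in> X" using A.zig_in_X[OF t(1)] .
  have "perm B.\<D> (0, s) = (if 2 * m \<le> piece m (h t) + 1 then (m, rank (tail m (h ` X)) (zig m (h t)))
      else (m - 1, rank (h ` X) (zig m (h t))))"
    using B.perm_zero[OF ht(1)] unfolding ht(2) .
  also have "\<dots> = (if 2 * 1 \<le> piece 1 t + 1 then (m, rank (tail 1 X) (zig 1 t)) else (m - 1, rank X (zig 1 t)))"
    unfolding high_h[OF t(1)] zig_h[OF t(1)] tail_h rank_h[OF A.tail_subset z] rank_h[OF order_refl z] ..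
  also have "\<dots> = hd_str m (perm A.\<D> (0, s))"
    unfolding t(2) A.perm_zero[OF t(1)] hd_str_def by simp
  finally show ?thesis .
qed

lemma perm_last_h:
  assumes "s < card (tail 1 X)"
  shows "perm B.\<D> (n - 1, s) = hd_str m (perm A.\<D> (1, s))"
proof -
  have "s \<in> rank (tail 1 X) ` tail 1 X" using assms unfolding rank_image[OF A.finite_tail] by simp
  then obtain t where t: "t \<in> tail 1 X" "s = rank (tail 1 X) t" by blast
  have tX: "t \<in> X" using t(1) A.tail_subset by blast
  have ht: "h t \<in> tail m (h ` X)" "rank (tail m (h ` X)) (h t) = s"
    using t rank_h[OF A.tail_subset tX] unfolding tail_h by auto
  have "perm B.\<D> (n - 1, s) = (m - 1, rank X t)"
    using B.perm_last[OF ht(1)] unfolding ht(2) rank_h[OF order_refl tX] .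
  moreover have "perm A.\<D> (1, s) = (0, rank X t)"
    using A.perm_last[OF t(1)] t(2) by simp
  ultimately show ?thesis by (simp add: hd_str_def)
qed

lemma label_sets_h: "Aset B.\<D> = Aset A.\<D>" "Bset B.\<D> = Bset A.\<D>" "Cset B.\<D> = Cset A.\<D>"
proof -
  have img: "rank (h ` X) ` {t \<in> h ` X. Q t} = rank X ` {t \<in> X. Q (h t)}" for Q
  proof -
    have "{t \<in> h ` X. Q t} = h ` {t \<in> X. Q (h t)}" by auto
    moreover have "rank (h ` X) ` h ` {t \<in> X. Q (h t)} = rank X ` {t \<in> X. Q (h t)}"
      unfolding image_image using rank_h[OF order_refl] by (intro image_cong) auto
    ultimately show ?thesis by (simp only:)
  qed
  have even: "even (piece m (h t)) \<longleftrightarrow> even (piece 1 t)" if "t \<in> X" for t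
    using piece_h[OF that] by presburger
  have MinX: "Min X \<in> X" using A.finite_X A.X_nonempty by simp
  have zig: "zig m (h t) = Min (h ` X) \<longleftrightarrow> zig 1 t = Min X" if "t \<in> X" for t
    unfolding zig_h[OF that] Min_h using h_eq_iff[OF A.zig_in_X[OF that] MinX] .
  show "Aset B.\<D> = Aset A.\<D>" "Bset B.\<D> = Bset A.\<D>" "Cset B.\<D> = Cset A.\<D>"
    unfolding A.label_sets B.label_sets img using even zig by (auto cong: conj_cong)
qed

text \<open>Data record only the order of the points, the parity of their pieces, the landing edges
  and which image is minimal. \<open>h\<close> respects all of these, and it carries the tail to the
  tail, so ranks there agree too.\<close>

lemma phi_data: "phi m n A.\<D> = B.\<D>"
proof -
  have N: "Nc (phi m n A.\<D>) = Nc B.\<D>" unfolding phi_sel(1) using Nc_B by (intro ext) (rule sym)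
  have perm: "perm (phi m n A.\<D>) x = perm B.\<D> x" for x
  proof (cases "x \<in> Lab n (Nc B.\<D>)")
    case True
    obtain r s where x: "x = (r, s)" by (cases x)
    have rs: "r < n" "s < Nc B.\<D> r" using True x by (auto simp: Lab_def)
    consider "r = 0" | "r = n - 1" "r \<noteq> 0" | "0 < r" "r < n - 1" using rs(1) by linarith
    then show ?thesis
    proof cases
      case 1
      then have "s < card X" using rs(2) B.zero_in_Z unfolding Nc_B Nc_A by (simp split: if_splits)
      then show ?thesis using True perm_zero_h x 1 unfolding phi_sel(2) N by (simp del: One_nat_def)
    next
      case 2
      then have "s < card (tail 1 X)" using rs B.last_notin_Z unfolding Nc_B Nc_A by (simp split: if_splits)
      from perm_last_h[OF this] show ?thesis
        using True x 2 unfolding phi_sel(2) N by (simp del: One_nat_def)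
    next
      case 3
      then show ?thesis using True B.perm_mid[OF 3 rs(2)] x unfolding phi_sel(2) N by (simp del: One_nat_def)
    qed
  next
    case False
    then show ?thesis using B.perm_outside[OF False] unfolding phi_sel(2) N by (simp del: One_nat_def)
  qed
  show ?thesis
  proof (rule sdata.equality)
    show "perm (phi m n A.\<D>) = perm B.\<D>" using perm by (rule ext)
  qed (simp_all add: N phi_sel(3-5) label_sets_h del: One_nat_def)
qed

end

section \<open>Bijectivity of \<open>phi\<close> on data\<close>

context star_map
begin

lemma conjugate_from:
  assumes "admissible 1 X"
  obtains h where "conjugate_orbits X m n h"
proof -
  interpret A: admissible_orbit 1 X using assms by unfold_locales simp_all
  obtain h where h: "conjugates 1 m X h" "admissible m (h ` X)" using A.transport[OF m_pos] .
  have "conjugate_orbits X m n h" by unfold_locales (use h m_pos assms in simp_all)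
  then show ?thesis using that by blast
qed

lemma conjugate_to:
  assumes "admissible m Y"
  obtains X h where "conjugate_orbits X m n h" "Y = h ` X"
proof -
  interpret A: admissible_orbit m Y using assms m_pos by unfold_locales
  obtain g where g: "conjugates m 1 Y g" "admissible 1 (g ` Y)" using A.transport[of 1] by auto
  obtain h where h: "conjugates 1 m (g ` Y) h" "h ` g ` Y = Y"
    using conjugates_inv[OF g(1) A.zig_in_X] by blast
  have "conjugate_orbits (g ` Y) m n h" by unfold_locales (use h g m_pos assms in simp_all)
  then show ?thesis using that h(2) by blast
qed

lemma phi_image: "phi m n ` Pset 1 2 0 LB = Pset m n (m - 1) LB"
proof -
  interpret H: star_map 1 2 by unfold_locales simp_all
  have P: "Pset 1 2 0 LB = {dataof 1 2 (spread 1 2 X) | X. admissible 1 X}"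
    using H.Pset_eq by simp
  show ?thesis
    unfolding P Pset_eq
  proof (intro equalityI subsetI)
    fix D assume "D \<in> phi m n ` {dataof 1 2 (spread 1 2 X) | X. admissible 1 X}"
    then obtain X where X: "admissible 1 X" "D = phi m n (dataof 1 2 (spread 1 2 X))" by blast
    obtain h where "conjugate_orbits X m n h" using conjugate_from[OF X(1)] .
    then interpret C: conjugate_orbits X m n h .
    have "D = C.B.\<D>" using X(2) C.phi_data by simp
    then show "D \<in> {dataof m n (spread m n X) | X. admissible m X}"
      using C.B.adm by blast
  next
    fix D assume "D \<in> {dataof m n (spread m n X) | X. admissible m X}"
    then obtain Y where Y: "admissible m Y" "D = dataof m n (spread m n Y)" by blast
    obtain X h where X: "conjugate_orbits X m n h" "Y = h ` X" using conjugate_to[OF Y(1)] .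
    from X(1) interpret C: conjugate_orbits X m n h .
    have "D = phi m n C.A.\<D>" using Y(2) X(2) C.phi_data by simp
    then show "D \<in> phi m n ` {dataof 1 2 (spread 1 2 X) | X. admissible 1 X}"
      using C.A.adm by blast
  qed
qed

text \<open>The rows over e_0 and e_{n-1} of the new data give back the two rows of the old data:
  permutation values there are heads of strings, and a head determines its string.\<close>

lemma phi_inj: "inj_on (phi m n) (Pset 1 2 0 LB)"
proof (rule inj_onI)
  interpret H: star_map 1 2 by unfold_locales simp_all
  have P: "Pset 1 2 0 LB = {dataof 1 2 (spread 1 2 X) | X. admissible 1 X}"
    using H.Pset_eq by simp
  fix D D' assume D: "D \<in> Pset 1 2 0 LB" "D' \<in> Pset 1 2 0 LB" and eq: "phi m n D = phi m n D'"
  obtain X where X: "D = dataof 1 2 (spread 1 2 X)" "admissible 1 X" using D(1) P by blast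
  obtain X' where X': "D' = dataof 1 2 (spread 1 2 X')" "admissible 1 X'" using D(2) P by blast
  interpret A: spread_orbit 1 2 X using X(2) by unfold_locales simp_all
  interpret A': spread_orbit 1 2 X' using X'(2) by unfold_locales simp_all
  have n: "0 < n" "n - 1 < n" "n - 1 \<noteq> 0" using n_ge_2 by auto
  have "Nc (phi m n D) 0 = Nc D 0" "Nc (phi m n D') 0 = Nc D' 0"
    "Nc (phi m n D) (n - 1) = Nc D 1" "Nc (phi m n D') (n - 1) = Nc D' 1"
    using zero_in_Z last_notin_Z n by (simp_all add: phi_sel(1))
  then have N01: "Nc D 0 = Nc D' 0" "Nc D 1 = Nc D' 1" using eq by auto
  have N: "Nc D = Nc D'"
  proof
    fix r :: nat
    consider "r = 0" | "r = 1" | "\<not> r < 2" by linarith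
    then show "Nc D r = Nc D' r"
      by cases (use N01 in \<open>simp_all add: X(1) X'(1) A.Nc_spread A'.Nc_spread del: One_nat_def\<close>)
  qed
  have phi0: "perm (phi m n E) (0, s) = hd_str m (perm E (0, s))" if "s < Nc E 0" for E s
    using that zero_in_Z n by (simp add: phi_sel(1,2) Lab_def)
  have phi1: "perm (phi m n E) (n - 1, s) = hd_str m (perm E (1, s))" if "s < Nc E 1" for E s
    using that last_notin_Z n by (simp add: phi_sel(1,2) Lab_def)
  \<comment> \<open>The bounds matter, as \<open>hd_str\<close> sends every nonzero edge to
    m.\<close>
  have hd: "x = y" if "hd_str m x = hd_str m y" "fst x < 2" "fst y < 2" for x y
    using that m_pos unfolding hd_str_def by (cases x, cases y) (auto split: if_splits)
  have perm: "perm D x = perm D' x" for x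
  proof (cases "x \<in> Lab 2 (Nc D)")
    case True
    then have "x \<in> Lab 2 (Nc A.\<D>)" "x \<in> Lab 2 (Nc A'.\<D>)" using N unfolding X(1) X'(1) by simp_all
    then have "perm D x \<in> Lab 2 (Nc D)" "perm D' x \<in> Lab 2 (Nc D')"
      using bij_betwE[OF A.perm_bij] bij_betwE[OF A'.perm_bij] unfolding X(1) X'(1) by blast+
    then have b: "fst (perm D x) < 2" "fst (perm D' x) < 2" by (auto simp: Lab_def)
    obtain r s where x: "x = (r, s)" by (cases x)
    have "r < 2" "s < Nc D r" using True x by (auto simp: Lab_def)
    then consider "r = 0" "s < Nc D 0" "s < Nc D' 0" | "r = 1" "s < Nc D 1" "s < Nc D' 1"
      unfolding N by (cases "r = 0"; cases "r = 1") auto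
    then show ?thesis
    proof cases
      case 1
      then show ?thesis using phi0[of s D] phi0[of s D'] eq hd[OF _ b] x by simp
    next
      case 2
      then show ?thesis using phi1[of s D] phi1[of s D'] eq hd[OF _ b] x by simp
    qed
  next
    case False
    then show ?thesis using A.perm_outside[of x] A'.perm_outside[of x] N X(1) X'(1) by simp
  qed
  show "D = D'"
  proof (rule sdata.equality)
    show "perm D = perm D'" using perm by (rule ext)
    show "Aset D = Aset D'" "Bset D = Bset D'" "Cset D = Cset D'"
      using eq phi_sel(3-5)[of m n D] phi_sel(3-5)[of m n D'] by simp_all
  qed (use N in simp_all)
qed

end

section \<open>The partition of the labels\<close>

lemma transitive_cycle:
  assumes fin: "finite L" and z: "z \<in> L" and closed: "f ` L \<subseteq> L" and inj: "inj_on f L"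
    and trans: "\<And>x y. x \<in> L \<Longrightarrow> y \<in> L \<Longrightarrow> \<exists>i. (f ^^ i) x = y"
  shows "bij_betw (\<lambda>i. (f ^^ i) z) {..<card L} L" "(f ^^ card L) z = z"
proof -
  define p where "p = (LEAST p. 0 < p \<and> (f ^^ p) z = z)"
  have "f z \<in> L" using z closed by blast
  then obtain i where "(f ^^ i) (f z) = z" using trans z by blast
  then have "0 < Suc i \<and> (f ^^ Suc i) z = z" by (simp add: funpow_swap1)
  then have p: "0 < p" "(f ^^ p) z = z"
    unfolding p_def using LeastI[of "\<lambda>p. 0 < p \<and> (f ^^ p) z = z"] by blast+
  have least: "(f ^^ q) z \<noteq> z" if "0 < q" "q < p" for q
    using not_less_Least[of q "\<lambda>p. 0 < p \<and> (f ^^ p) z = z"] that unfolding p_def by blast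
  have in_L: "(f ^^ i) x \<in> L" if "x \<in> L" for i x
    using that closed by (induction i) auto
  have cancel: "x = y" if "x \<in> L" "y \<in> L" "(f ^^ i) x = (f ^^ i) y" for i x y
    using that
  proof (induction i)
    case (Suc i)
    then show ?case using inj_onD[OF inj, of "(f ^^ i) x" "(f ^^ i) y"] in_L by simp
  qed simp
  have diff: "i = j" if "i \<le> j" "j < p" "(f ^^ i) z = (f ^^ j) z" for i j
  proof (rule ccontr)
    assume "i \<noteq> j"
    then have "(f ^^ j) z = (f ^^ i) ((f ^^ (j - i)) z)"
      using that(1) by (metis comp_apply funpow_add le_add_diff_inverse)
    then have "z = (f ^^ (j - i)) z" using cancel[OF z in_L[OF z]] that(3) by metis
    moreover have "0 < j - i" "j - i < p" using that(1,2) \<open>i \<noteq> j\<close> by linarith+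
    ultimately show False using least[of "j - i"] by metis
  qed
  have "inj_on (\<lambda>i. (f ^^ i) z) {..<p}"
  proof (rule inj_onI)
    fix i j assume "i \<in> {..<p}" "j \<in> {..<p}" "(f ^^ i) z = (f ^^ j) z"
    then show "i = j" using diff[of i j] diff[of j i] by (cases "i \<le> j") auto
  qed
  moreover have "(\<lambda>i. (f ^^ i) z) ` {..<p} = L"
  proof (intro equalityI subsetI)
    fix y assume "y \<in> L"
    then obtain i where i: "(f ^^ i) z = y" using trans z by blast
    have mult: "(f ^^ (k * p)) z = z" for k by (induction k) (simp_all add: funpow_add p(2))
    have "(f ^^ i) z = (f ^^ (i mod p + i div p * p)) z" by (simp only: mod_div_mult_eq)
    then have "y = (f ^^ (i mod p)) z" using i by (simp only: funpow_add o_apply mult)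
    then show "y \<in> (\<lambda>i. (f ^^ i) z) ` {..<p}" using p(1) by auto
  qed (use in_L z in auto)
  ultimately have bij: "bij_betw (\<lambda>i. (f ^^ i) z) {..<p} L" by (simp add: bij_betw_def)
  then have "card L = p" using bij_betw_same_card by fastforce
  then show "bij_betw (\<lambda>i. (f ^^ i) z) {..<card L} L" "(f ^^ card L) z = z" using bij p(2) by auto
qed

section \<open>The cycle of labels read backwards from (m, 0)\<close>

context spread_orbit
begin

abbreviation L :: "(nat \<times> nat) set" where "L \<equiv> Lab n (Nc \<D>)"

lemma Nc_pos: "r < n \<Longrightarrow> 0 < Nc \<D> r"
  using finite_edge_set X_nonempty Min_in_tail by (auto simp: Nc_spread card_gt_0_iff edge_set_def)

lemma zero_in_L: "r < n \<Longrightarrow> (r, 0) \<in> L"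
  using Nc_pos by (simp add: Lab_def)

lemma L_Sigma: "L = Sigma {..<n} (\<lambda>r. {..<Nc \<D> r})"
  by (auto simp: Lab_def)

lemma finite_L: "finite L"
  unfolding L_Sigma by simp

lemma card_L: "card L = npts n \<D>"
  unfolding L_Sigma npts_def by simp

lemma rank_Min: "rank X (Min X) = 0" "rank (tail m X) (Min X) = 0"
proof -
  have "Min X \<in> X" using finite_X X_nonempty by simp
  then show "rank X (Min X) = 0" using rank_eq_0_iff[OF finite_X] by simp
  show "rank (tail m X) (Min X) = 0"
    using rank_eq_0_iff[OF finite_tail Min_in_tail] Min_tail by simp
qed

lemma perm_row_zero:
  assumes "0 < r" "r < n"
  shows "perm \<D> (r, 0) = ((r + m) mod n, 0)"
proof (cases "r = n - 1")
  case True
  then show ?thesis using perm_last[OF Min_in_tail] last_step rank_Min by simp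
next
  case False
  then show ?thesis using perm_mid[of r 0] Nc_pos[of r] assms by simp
qed

abbreviation \<rho> :: "nat \<times> nat \<Rightarrow> nat \<times> nat" where "\<rho> \<equiv> pinv n \<D>"

lemma perm_inj: "inj_on (perm \<D>) L" and perm_image: "perm \<D> ` L = L"
  using perm_bij by (auto simp: bij_betw_def)

lemma pinv_perm: "x \<in> L \<Longrightarrow> \<rho> (perm \<D> x) = x"
  unfolding pinv_def by (rule the_inv_into_f_f[OF perm_inj])

lemma perm_pinv: "x \<in> L \<Longrightarrow> perm \<D> (\<rho> x) = x"
  unfolding pinv_def using f_the_inv_into_f[OF perm_inj] perm_image by simp

lemma pinv_in_L: "x \<in> L \<Longrightarrow> \<rho> x \<in> L"
  unfolding pinv_def using the_inv_into_into[OF perm_inj, of x L] perm_image by simp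

lemma pinv_transitive:
  assumes "x \<in> L" "y \<in> L"
  shows "\<exists>i. (\<rho> ^^ i) x = y"
proof -
  obtain i where i: "(perm \<D> ^^ i) y = x" using perm_transitive[OF assms(2,1)] by blast
  have "(\<rho> ^^ j) ((perm \<D> ^^ j) y) = y" for j
  proof (induction j)
    case (Suc j)
    have "(perm \<D> ^^ j) y \<in> L" using assms(2) perm_image by (induction j) auto
    then show ?case using Suc pinv_perm by (simp add: funpow_swap1[of "\<rho>"])
  qed simp
  then show ?thesis using i by blast
qed

text \<open>Counting from 0, \<open>bwd j\<close> is \<open>\<pi>\<^bsup>-(j+1)\<^esup>(m, 0)\<close>, matching the index of \<^const>\<open>cflag\<close>.\<close>
definition bwd :: "nat \<Rightarrow> nat \<times> nat" where
  "bwd j = (\<rho> ^^ (j + 1)) (m, 0)"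

lemma bwd_Suc: "bwd (Suc j) = \<rho> (bwd j)"
  by (simp add: bwd_def)

lemma bwd_in_L: "bwd j \<in> L"
  using zero_in_L[OF m_less] pinv_in_L unfolding bwd_def by (induction j) auto

lemma perm_bwd_0: "perm \<D> (bwd 0) = (m, 0)"
  using perm_pinv[OF zero_in_L[OF m_less]] by (simp add: bwd_def)

lemma perm_bwd_Suc: "perm \<D> (bwd (Suc j)) = bwd j"
  unfolding bwd_Suc by (rule perm_pinv[OF bwd_in_L])

lemma bwd_bij: "bij_betw bwd {..<card L} L" and bwd_last: "bwd (card L - 1) = (m, 0)"
proof -
  have z: "(m, 0) \<in> L" using zero_in_L[OF m_less] .
  have closed: "\<rho> ` L \<subseteq> L" using pinv_in_L by blast
  have inj: "inj_on \<rho> L" using perm_pinv by (metis inj_onI)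
  have eq: "bwd = (\<lambda>i. (\<rho> ^^ i) (\<rho> (m, 0)))" by (simp add: fun_eq_iff bwd_def funpow_swap1)
  show "bij_betw bwd {..<card L} L"
    unfolding eq using transitive_cycle(1)[OF finite_L pinv_in_L[OF z] closed inj pinv_transitive] .
  have "0 < card L" using z finite_L card_gt_0_iff by blast
  then show "bwd (card L - 1) = (m, 0)"
    using transitive_cycle(2)[OF finite_L z closed inj pinv_transitive] by (simp add: bwd_def)
qed

lemma bwd_inj: "i < card L \<Longrightarrow> j < card L \<Longrightarrow> bwd i = bwd j \<longleftrightarrow> i = j"
  using bwd_bij unfolding bij_betw_def inj_on_def by auto

lemma n_le_card: "n \<le> card L"
proof -
  have "card ((\<lambda>r. (r, 0 :: nat)) ` {..<n}) \<le> card L"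
    using zero_in_L by (intro card_mono finite_L) auto
  then show ?thesis by (simp add: card_image inj_on_def)
qed

text \<open>Read forwards from (m, 0), the permutation merely rotates labels of rank 0 until edge 0
  is reached, and by coprimality all n edges are met on the way. In the backward list these labels
  come last.\<close>

lemma bwd_from_end: "i < n \<Longrightarrow> bwd (card L - 1 - i) = ((m + i * m) mod n, 0)"
proof (induction i)
  case 0
  then show ?case using bwd_last m_less by simp
next
  case (Suc i)
  have "Suc (card L - 1 - Suc i) = card L - 1 - i" using Suc.prems n_le_card by simp
  then have eq: "bwd (card L - 1 - Suc i) = perm \<D> (bwd (card L - 1 - i))"
    using perm_bwd_Suc[of "card L - 1 - Suc i"] by simp
  have "(m + i * m) mod n \<noteq> 0"
  proof
    assume "(m + i * m) mod n = 0"
    then have "n dvd m * Suc i" by (auto simp: algebra_simps)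
    then have "n dvd Suc i" using cop by (metis coprime_commute coprime_dvd_mult_right_iff)
    then show False using Suc.prems by (meson dvd_imp_le not_less zero_less_Suc)
  qed
  then have "perm \<D> ((m + i * m) mod n, 0) = (((m + i * m) mod n + m) mod n, 0)"
    using n_ge_2 by (intro perm_row_zero) auto
  also have "((m + i * m) mod n + m) mod n = (m + Suc i * m) mod n"
    unfolding mod_add_left_eq by (simp add: algebra_simps)
  finally show ?case using eq Suc by simp
qed

text \<open>The last n entries are distinct and lie among the n labels of rank 0, hence are all of
  them. This is the reason for the bound \<open>npts n D - n\<close> in \<open>betaset\<close>:
  \<alpha> and \<beta> share out exactly the labels of nonzero rank.\<close>

lemma bwd_snd_zero_iff:
  assumes "j < card L"
  shows "snd (bwd j) = 0 \<longleftrightarrow> card L - n \<le> j"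
proof -
  let ?O = "(\<lambda>r. (r, 0 :: nat)) ` {..<n}"
  have sub: "bwd ` {card L - n..<card L} \<subseteq> ?O"
  proof
    fix y assume "y \<in> bwd ` {card L - n..<card L}"
    then obtain i where i: "card L - n \<le> i" "i < card L" "y = bwd i" by auto
    then have "bwd (card L - 1 - (card L - 1 - i)) = ((m + (card L - 1 - i) * m) mod n, 0)"
      by (intro bwd_from_end) linarith
    then show "y \<in> ?O" using i n_ge_2 by auto
  qed
  have "inj_on bwd {card L - n..<card L}"
    using bwd_bij by (auto simp: bij_betw_def inj_on_def)
  then have "card (bwd ` {card L - n..<card L}) = n"
    using n_le_card by (simp add: card_image)
  then have eq: "bwd ` {card L - n..<card L} = ?O"
    using sub by (intro card_subset_eq) (auto simp: card_image inj_on_def)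
  have "snd (bwd j) = 0 \<longleftrightarrow> bwd j \<in> ?O"
    using bwd_in_L[of j] by (cases "bwd j") (auto simp: Lab_def)
  also have "\<dots> \<longleftrightarrow> card L - n \<le> j"
    unfolding eq[symmetric]
  proof
    assume "bwd j \<in> bwd ` {card L - n..<card L}"
    then obtain i where i: "bwd j = bwd i" "card L - n \<le> i" "i < card L" by auto
    then show "card L - n \<le> j" using bwd_inj[OF assms i(3)] by blast
  qed (use assms in simp)
  finally show ?thesis .
qed

lemma bwd_cases:
  assumes "y \<in> L" "snd y \<noteq> 0"
  obtains j where "j < card L - n" "y = bwd j"
proof -
  obtain j where j: "j < card L" "y = bwd j"
    using assms(1) bwd_bij unfolding bij_betw_def by auto
  then have "j < card L - n" using bwd_snd_zero_iff[OF j(1)] assms(2) by simp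
  then show ?thesis using that j(2) by blast
qed

lemma bwd_nonzero: "j < card L - n \<Longrightarrow> snd (bwd j) \<noteq> 0"
  using bwd_snd_zero_iff[of j] by simp

lemma beta_bwd:
  assumes "j < card L - n"
  shows "bwd j \<in> betaset m n \<D> \<longleftrightarrow> cflag \<rho> (Aset \<D>) m j"
    "bwd j \<in> alphaset m n \<D> \<longleftrightarrow> \<not> cflag \<rho> (Aset \<D>) m j"
proof -
  have "betaset m n \<D> = {bwd j | j. j < card L - n \<and> cflag \<rho> (Aset \<D>) m j}"
    "alphaset m n \<D> = {bwd j | j. j < card L - n \<and> \<not> cflag \<rho> (Aset \<D>) m j}"
    unfolding betaset_def alphaset_def bwd_def card_L[symmetric] by (simp_all add: Suc_le_eq)
  moreover have "i = j" if "bwd j = bwd i" "i < card L - n" for i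
    using bwd_inj[of i j] that assms by simp
  ultimately show "bwd j \<in> betaset m n \<D> \<longleftrightarrow> cflag \<rho> (Aset \<D>) m j"
    "bwd j \<in> alphaset m n \<D> \<longleftrightarrow> \<not> cflag \<rho> (Aset \<D>) m j"
    using assms by blast+
qed

lemma alpha_iff: "y \<in> L \<Longrightarrow> snd y \<noteq> 0 \<Longrightarrow> y \<in> alphaset m n \<D> \<longleftrightarrow> y \<notin> betaset m n \<D>"
  using bwd_cases[of y] beta_bwd by metis

lemma perm_bwd_eq_iff: "j < card L \<Longrightarrow> perm \<D> (bwd j) = (m, 0) \<longleftrightarrow> j = 0"
proof (cases j)
  case (Suc i)
  assume "j < card L"
  then show ?thesis using bwd_inj[of i "card L - 1"] bwd_last perm_bwd_Suc[of i] Suc by simp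
qed (simp add: perm_bwd_0)

text \<open>Frees the recursion from positions in the cycle, which shift when strings are inserted;
  permutation and labels can be compared directly. The first alternative is the starting value at
  the preimage of (m, 0).\<close>

lemma beta_rec:
  assumes "y \<in> L" "snd y \<noteq> 0"
  shows "y \<in> betaset m n \<D> \<longleftrightarrow> perm \<D> y = (m, 0) \<or>
    (perm \<D> y \<in> betaset m n \<D> \<longleftrightarrow> \<not> (fst y = 0 \<and> snd y \<in> Aset \<D>))"
proof -
  obtain j where j: "j < card L - n" "y = bwd j" using bwd_cases[OF assms] .
  show ?thesis
  proof (cases j)
    case 0
    then show ?thesis using beta_bwd(1)[OF j(1)] j(2) perm_bwd_0 by simp
  next
    case (Suc i)
    have x: "(\<rho> ^^ (i + 2)) (m, 0) = y" using j(2) Suc by (simp add: bwd_def)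
    have "cflag \<rho> (Aset \<D>) m j \<longleftrightarrow> (cflag \<rho> (Aset \<D>) m i \<longleftrightarrow> \<not> (fst y = 0 \<and> snd y \<in> Aset \<D>))"
      unfolding Suc cflag.simps x Let_def by auto
    then show ?thesis
      using beta_bwd(1)[OF j(1)] beta_bwd(1)[of i] perm_bwd_Suc[of i] perm_bwd_eq_iff[of j] j Suc
      by auto
  qed
qed

lemma beta_induct [consumes 2, case_names step]:
  assumes "y \<in> L" "snd y \<noteq> 0"
    and step: "\<And>y. y \<in> L \<Longrightarrow> snd y \<noteq> 0 \<Longrightarrow> (perm \<D> y \<noteq> (m, 0) \<Longrightarrow> snd (perm \<D> y) \<noteq> 0 \<and> Q (perm \<D> y)) \<Longrightarrow> Q y"
  shows "Q y"
proof -
  have "Q (bwd j)" if "j < card L - n" for j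
    using that
  proof (induction j)
    case 0
    then show ?case using step[OF bwd_in_L bwd_nonzero] perm_bwd_0 by blast
  next
    case (Suc j)
    then show ?case using step[OF bwd_in_L bwd_nonzero[OF Suc.prems]] perm_bwd_Suc[of j] bwd_nonzero[of j] by simp
  qed
  then show ?thesis using bwd_cases[OF assms(1,2)] by metis
qed

text \<open>Labels A and B rule out the image \<open>Min X\<close>, the common minimum of X and its
  tail, so the rank is positive on either landing edge and the image belongs to the
  partition.\<close>

lemma perm_label_nonzero:
  assumes "s \<in> Aset \<D> \<union> Bset \<D>"
  shows "snd (perm \<D> (0, s)) \<noteq> 0"
proof -
  obtain t where t: "t \<in> X" "s = rank X t" "zig m t \<noteq> Min X"
    using assms unfolding label_sets by auto
  have "rank X (zig m t) \<noteq> 0" using rank_eq_0_iff[OF finite_X zig_in_X[OF t(1)]] t(3) by simp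
  moreover have "rank (tail m X) (zig m t) \<noteq> 0" if "2 * m \<le> piece m t + 1"
  proof -
    have "zig m t \<in> tail m X" using that t(1) unfolding tail_def by blast
    then show ?thesis using rank_eq_0_iff[OF finite_tail] t(3) Min_tail by simp
  qed
  ultimately show ?thesis using perm_zero[OF t(1)] t(2) by simp
qed

text \<open>For k = m - 1 the edge q is n - 1, and no r satisfies k < r < m. Membership in \<alpha>
  turns into non-membership in \<beta> because the labels concerned have nonzero rank.\<close>

lemma TTcond_iff:
  "TTcond m n (m - 1) LB \<D> \<longleftrightarrow>
    (\<forall>s. s + 1 < card X \<longrightarrow> (s \<in> Bset \<D> \<longrightarrow> perm \<D> (0, s) \<notin> betaset m n \<D>)
       \<and> (s \<in> Aset \<D> \<longrightarrow> perm \<D> (0, s) \<in> betaset m n \<D>))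
    \<and> (\<forall>s. 0 < s \<and> s < card (tail m X) \<longrightarrow> snd (perm \<D> (n - 1, s)) > snd (perm \<D> (0, 0))
       \<longrightarrow> perm \<D> (n - 1, s) \<in> betaset m n \<D>)"
proof -
  have q: "(m - 1 + n - m) mod n = n - 1" using m_pos n_ge_2 by simp
  have N: "Nc \<D> 0 = card X" "Nc \<D> (n - 1) = card (tail m X)"
    using n_ge_2 by (simp_all only: Nc_spread edge_set_zero edge_set_last) auto
  have alpha: "perm \<D> (0, s) \<in> alphaset m n \<D> \<longleftrightarrow> perm \<D> (0, s) \<notin> betaset m n \<D>"
    if "s + 1 < card X" "s \<in> Bset \<D>" for s
  proof -
    have "(0, s) \<in> L" using that(1) N n_ge_2 by (simp add: Lab_def)
    then have "perm \<D> (0, s) \<in> L" using perm_image by blast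
    then show ?thesis using alpha_iff perm_label_nonzero that(2) by blast
  qed
  have "\<not> (m - 1 < r \<and> r < m)" for r by linarith
  then show ?thesis
    unfolding TTcond_def Let_def q N using alpha by auto
qed

end

section \<open>The partition along inserted strings\<close>

context conjugate_orbits
begin

lemma perm_A_cases:
  assumes "y \<in> A.L"
  shows "perm A.\<D> y \<in> A.L" "fst (perm A.\<D> y) < 2"
proof -
  show "perm A.\<D> y \<in> A.L" using A.perm_image assms by blast
  then show "fst (perm A.\<D> y) < 2" by (auto simp: Lab_def)
qed

lemma hd_str_eq_iff: "fst y < 2 \<Longrightarrow> hd_str m y = (m, 0) \<longleftrightarrow> y = (1, 0)"
  using B.m_pos by (cases y) (auto simp: hd_str_def)

lemma beta_Z_string:
  assumes "r \<in> B.Z" "r < n" "s < card X" "s \<noteq> 0"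
  shows "(r, s) \<in> betaset m n B.\<D> \<longleftrightarrow> (m - 1, s) \<in> betaset m n B.\<D>"
  using assms(1,2)
proof (induction rule: B.Z_forward_induct)
  case (step r)
  have N: "s < Nc B.\<D> r" using step.hyps assms(3) unfolding Nc_B Nc_A by simp
  then have "(r, s) \<in> B.L" using step.hyps by (simp add: Lab_def)
  from B.beta_rec[OF this] show ?case
    using step assms(4) B.perm_mid[OF step.hyps(1,2) N] by simp
qed simp

lemma beta_notin_Z_string:
  assumes "r \<notin> B.Z" "r < n" "s < card (tail 1 X)" "s \<noteq> 0"
  shows "(r, s) \<in> betaset m n B.\<D> \<longleftrightarrow> (m, s) \<in> betaset m n B.\<D>"
  using assms(1,2)
proof (induction rule: B.notin_Z_forward_induct)
  case (step r)
  have N: "s < Nc B.\<D> r" using step.hyps assms(3) unfolding Nc_B Nc_A by simp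
  then have "(r, s) \<in> B.L" using step.hyps by (simp add: Lab_def)
  from B.beta_rec[OF this] show ?case
    using step assms(4) B.perm_mid[OF step.hyps(1,2) N] by simp
qed simp

text \<open>One step of the 1/2-cycle corresponds to a whole string. The side is constant along the
  string, and a change can occur only on leaving its last element, which for (0, s) is again (0, s)
  with the same label.\<close>

lemma beta_hd_str:
  assumes "y \<in> A.L" "snd y \<noteq> 0"
  shows "y \<in> betaset 1 2 A.\<D> \<longleftrightarrow> hd_str m y \<in> betaset m n B.\<D>"
  using assms
proof (induction rule: A.beta_induct)
  case (step y)
  obtain r s where y: "y = (r, s)" by (cases y)
  have s: "s \<noteq> 0" using step.hyps y by simp
  have IH: "perm A.\<D> y = (1, 0) \<or>
      (perm A.\<D> y \<in> betaset 1 2 A.\<D> \<longleftrightarrow> hd_str m (perm A.\<D> y) \<in> betaset m n B.\<D>)"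
    using step.IH by blast
  note eq = hd_str_eq_iff[OF perm_A_cases(2)[OF step.hyps(1)]]
  have "r < 2" "s < Nc A.\<D> r" using step.hyps(1) y by (auto simp: Lab_def)
  then consider "r = 0" "s < Nc A.\<D> 0" | "r = 1" "s < Nc A.\<D> 1"
    by (cases "r = 0"; cases "r = 1") auto
  then show ?case
  proof cases
    case 1
    have sX: "s < card X" using 1(2) unfolding Nc_A .
    have "0 < n" using B.n_ge_2 by simp
    have "(0, s) \<in> B.L" using sX B.zero_in_Z \<open>0 < n\<close> by (simp add: Lab_def Nc_B Nc_A[simplified])
    note rec = B.beta_rec[OF this, unfolded perm_zero_h[OF sX] label_sets_h]
    show ?thesis
      using rec A.beta_rec[OF step.hyps] beta_Z_string[OF B.zero_in_Z \<open>0 < n\<close> sX s] IH eq s y 1(1)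
      by (auto simp: hd_str_def)
  next
    case 2
    have sX: "s < card (tail 1 X)" using 2(2) unfolding Nc_A .
    have n: "n - 1 < n" "n - 1 \<noteq> 0" using B.n_ge_2 by auto
    have "(n - 1, s) \<in> B.L" using sX B.last_notin_Z n by (simp add: Lab_def Nc_B Nc_A[simplified])
    note rec = B.beta_rec[OF this, unfolded perm_last_h[OF sX]]
    show ?thesis
      using rec A.beta_rec[OF step.hyps] beta_notin_Z_string[OF B.last_notin_Z n(1) sX s] IH eq s y 2(1) n
      by (auto simp: hd_str_def)
  qed
qed

lemma TTcond_h: "TTcond m n (m - 1) LB B.\<D> \<longleftrightarrow> TTcond 1 2 0 LB A.\<D>"
proof -
  have card: "card (h ` X) = card X" using card_image[OF h_inj] .
  have snd_hd: "snd (hd_str m y) = snd y" for y by (simp add: hd_str_def)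
  have in_A: "(0, s) \<in> A.L" if "s < card X" for s using that Nc_A by (simp add: Lab_def)
  have in_A1: "(1, s) \<in> A.L" if "s < card (tail 1 X)" for s using that Nc_A by (simp add: Lab_def)
  have zero: "perm B.\<D> (0, s) \<in> betaset m n B.\<D> \<longleftrightarrow> perm A.\<D> (0, s) \<in> betaset 1 2 A.\<D>"
    if "s + 1 < card X" "s \<in> Aset A.\<D> \<union> Bset A.\<D>" for s
  proof -
    have s: "s < card X" using that(1) by simp
    show ?thesis unfolding perm_zero_h[OF s]
      using beta_hd_str[OF perm_A_cases(1)[OF in_A[OF s]] A.perm_label_nonzero[OF that(2)]] by blast
  qed
  have "0 < card X" using A.finite_X A.X_nonempty card_gt_0_iff by blast
  note B0 = perm_zero_h[OF this]
  \<comment> \<open>The strict inequality makes the larger rank nonzero, so that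
    \<open>beta_hd_str\<close> applies; where it fails, both implications hold trivially.\<close>
  have last: "(snd (perm B.\<D> (0, 0)) < snd (perm B.\<D> (n - 1, s)) \<longrightarrow> perm B.\<D> (n - 1, s) \<in> betaset m n B.\<D>)
      \<longleftrightarrow> (snd (perm A.\<D> (0, 0)) < snd (perm A.\<D> (1, s)) \<longrightarrow> perm A.\<D> (1, s) \<in> betaset 1 2 A.\<D>)"
    if s: "s < card (tail 1 X)" for s
    unfolding perm_last_h[OF s] B0 snd_hd
    using beta_hd_str[OF perm_A_cases(1)[OF in_A1[OF s]]] by (metis less_nat_zero_code)
  have "TTcond 1 2 (1 - 1) LB A.\<D> \<longleftrightarrow>
    (\<forall>s. s + 1 < card X \<longrightarrow> (s \<in> Bset A.\<D> \<longrightarrow> perm A.\<D> (0, s) \<notin> betaset 1 2 A.\<D>)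
       \<and> (s \<in> Aset A.\<D> \<longrightarrow> perm A.\<D> (0, s) \<in> betaset 1 2 A.\<D>))
    \<and> (\<forall>s. 0 < s \<and> s < card (tail 1 X) \<longrightarrow> snd (perm A.\<D> (1, s)) > snd (perm A.\<D> (0, 0))
       \<longrightarrow> perm A.\<D> (1, s) \<in> betaset 1 2 A.\<D>)"
    using A.TTcond_iff by simp
  then show ?thesis
    unfolding B.TTcond_iff label_sets_h card card_tail_h using zero last
    by (simp del: One_nat_def)
qed

end

context star_map
begin

lemma TTcond_phi:
  assumes "D \<in> Pset 1 2 0 LB"
  shows "TTcond m n (m - 1) LB (phi m n D) \<longleftrightarrow> TTcond 1 2 0 LB D"
proof -
  interpret H: star_map 1 2 by unfold_locales simp_all
  obtain X where X: "admissible 1 X" "D = dataof 1 2 (spread 1 2 X)"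
    using assms H.Pset_eq by auto
  obtain h where "conjugate_orbits X m n h" using conjugate_from[OF X(1)] .
  then interpret C: conjugate_orbits X m n h .
  show ?thesis unfolding X(2) C.phi_data by (rule C.TTcond_h)
qed

lemma phi_bij: "bij_betw (phi m n) (Pset 1 2 0 LB) (Pset m n (m - 1) LB)"
  using phi_inj phi_image by (simp add: bij_betw_def)

lemma phi_TT_bij: "bij_betw (phi m n) (TT 1 2 0 LB) (TT m n (m - 1) LB)"
proof (rule bij_betw_subset[OF phi_bij])
  show "TT 1 2 0 LB \<subseteq> Pset 1 2 0 LB" by (auto simp: TT_def)
  show "phi m n ` TT 1 2 0 LB = TT m n (m - 1) LB"
    unfolding TT_def phi_image[symmetric] using TTcond_phi by auto
qed

end

theorem theorem2p14:
  fixes m n :: nat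
  assumes "0 < m" and "2 * m < n" and "coprime m n"
  shows "bij_betw (phi m n) (Pset 1 2 0 LB) (Pset m n (m - 1) LB)
       \<and> bij_betw (phi m n) (TT 1 2 0 LB) (TT m n (m - 1) LB)"
proof -
  interpret star_map m n using assms by unfold_locales simp_all
  show ?thesis using phi_bij phi_TT_bij by blast
qed

end
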